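(* Let $d=1$, $\mu>-\frac12$, $\beta>-1$ with $2\mu+\beta+1>0$, and $n\ge0$. Define the polynomials $\{\mathsf{Y}^{\mathsf L}_{n-k,n}:0\le k\le n\}$ recursively as follows: for $k=0,1$ (with $k\le n$), $\mathsf{Y}^{\mathsf L}_{n-k,n}=\mathsf{U}^{\mathsf L}_{n-k,n}$, and for $k=2,3,\ldots,n$, $$\mathsf{Y}^{\mathsf L}_{n-k,n}(x,t)=\mathsf{U}^{\mathsf L}_{n-k,n}(x,t)-\sum_{1\le i\le\lfloor k/2\rfloor}c_{i,k}\,\mathsf{Y}^{\mathsf L}_{n-k+2i,n}(x,t),$$ where $$c_{i,k}=\frac{k!\,(\mu+i+n-k+1)_i}{2^{2i}(k-2i)!\,i!\,(\mu+n-k+\frac12)_{2i}\,(2\mu+\beta+2n-k+1)_{2i}}.$$ Then $\{\mathsf{Y}^{\mathsf L}_{n-k,n}:0\le k\le n\}$ is a basis of $\mathcal{V}_n(\mathbb{V}^2,W_{\beta,\mu})$ and it is mutually biorthogonal to the basis $\{\mathsf{V}^{\mathsf L}_{k,n}:0\le k\le n\}$, i.e. $\int_{\mathbb{V}^2}\mathsf{Y}^{\mathsf L}_{k,n}\mathsf{V}^{\mathsf L}_{j,n}W_{\beta,\mu}\,dx\,dt$ is zero if $k\ne j$ and nonzero if $k=j$.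
   Context: $\mathbb{V}^2=\{(x,t)\in\mathbb{R}^2:|x|\le t,\ t\ge0\}$, $W_{\beta,\mu}(x,t)=(t^2-x^2)^{\mu-\frac12}t^\beta e^{-t}$. $\mathcal{V}_n(\mathbb{V}^2,W_{\beta,\mu})$ is the space of polynomials of degree at most $n$ in $(x,t)$ orthogonal to all polynomials of degree at most $n-1$ with respect to $\int_{\mathbb{V}^2}fg\,W_{\beta,\mu}\,dx\,dt$. $(a)_k=a(a+1)\cdots(a+k-1)$. For $0\le k\le n$, $$\mathsf{U}^{\mathsf L}_{k,n}(x,t)=\frac{1}{W_{\beta,\mu}(x,t)}\,\frac{1}{t^{2k+2\mu}}\left[\frac{\partial^{k}}{\partial x^{k}}(t^2-x^2)^{k+\mu-\frac12}\right]\left[\frac{\partial^{n-k}}{\partial t^{n-k}}\bigl(t^{n+k+\beta+2\mu}e^{-t}\bigr)\right],$$ and $\mathsf{V}^{\mathsf L}_{k,n}$ is the unique element of $\mathcal{V}_n(\mathbb{V}^2,W_{\beta,\mu})$ such that $\mathsf{V}^{\mathsf L}_{k,n}(x,t)-t^{n-k}x^k$ is a polynomial of degree at most $n-1$. *)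

theory Defs
  imports "HOL-Analysis.Analysis" "HOL-Library.Function_Algebras"
begin

text \<open>
  Bivariate real polynomials are represented by the polynomial functions
  \<^typ>\<open>real \<times> real \<Rightarrow> real\<close> they induce, with arguments written \<open>(x, t)\<close>.
  Addition of functions is pointwise (\<^theory>\<open>HOL-Library.Function_Algebras\<close>);
  the scalar multiplication below makes them a real vector space, which gives access to the
  library's \<open>span\<close> and \<open>independent\<close>.
\<close>

definition fscale :: "real \<Rightarrow> (real \<times> real \<Rightarrow> real) \<Rightarrow> real \<times> real \<Rightarrow> real" where
  "fscale c f = (\<lambda>z. c * f z)"

global_interpretation fvs: vector_space fscale
  by unfold_locales (auto simp: fscale_def fun_eq_iff algebra_simps)

definition indexed_basis ::
    "'i set \<Rightarrow> ('i \<Rightarrow> real \<times> real \<Rightarrow> real) \<Rightarrow> (real \<times> real \<Rightarrow> real) set \<Rightarrow> bool" where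
  "indexed_basis I f S \<longleftrightarrow> inj_on f I \<and> fvs.independent (f ` I) \<and> fvs.span (f ` I) = S"

text \<open>
  Polynomials of total degree strictly less than \<open>m\<close>: degree at most \<open>n\<close> is \<open>poly_deg_less (Suc n)\<close>,
  and degree at most \<open>n - 1\<close> is \<open>poly_deg_less n\<close>, which for \<open>n = 0\<close> is the zero space.
\<close>

definition poly_deg_less :: "nat \<Rightarrow> (real \<times> real \<Rightarrow> real) set" where
  "poly_deg_less m = fvs.span {(\<lambda>(x, t). x ^ i * t ^ j) | i j. i + j < m}"

definition V2 :: "(real \<times> real) set" where
  "V2 = {(x, t). \<bar>x\<bar> \<le> t \<and> t \<ge> 0}"

definition W :: "real \<Rightarrow> real \<Rightarrow> real \<times> real \<Rightarrow> real" where
  "W \<beta> \<mu> = (\<lambda>(x, t). (t\<^sup>2 - x\<^sup>2) powr (\<mu> - 1/2) * t powr \<beta> * exp (- t))"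

definition W_inner ::
    "real \<Rightarrow> real \<Rightarrow> (real \<times> real \<Rightarrow> real) \<Rightarrow> (real \<times> real \<Rightarrow> real) \<Rightarrow> real" where
  "W_inner \<beta> \<mu> f g = (LINT z:V2|lborel. f z * g z * W \<beta> \<mu> z)"

definition orth_polys :: "real \<Rightarrow> real \<Rightarrow> nat \<Rightarrow> (real \<times> real \<Rightarrow> real) set" where
  "orth_polys \<beta> \<mu> n =
     {P \<in> poly_deg_less (Suc n). \<forall>Q \<in> poly_deg_less n. W_inner \<beta> \<mu> P Q = 0}"

definition U_formula :: "real \<Rightarrow> real \<Rightarrow> nat \<Rightarrow> nat \<Rightarrow> real \<Rightarrow> real \<Rightarrow> real" where
  "U_formula \<beta> \<mu> k n x t =
     1 / W \<beta> \<mu> (x, t) * (1 / t powr (2 * real k + 2 * \<mu>))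
     * (deriv ^^ k) (\<lambda>y. (t\<^sup>2 - y\<^sup>2) powr (real k + \<mu> - 1/2)) x
     * (deriv ^^ (n - k)) (\<lambda>s. s powr (real n + real k + \<beta> + 2 * \<mu>) * exp (- s)) t"

text \<open>
  The Rodrigues formula is only meaningful in the interior \<open>\<bar>x\<bar> < t\<close> of the cone, so the polynomial
  is the one that agrees with it there.
\<close>

definition UL :: "real \<Rightarrow> real \<Rightarrow> nat \<Rightarrow> nat \<Rightarrow> real \<times> real \<Rightarrow> real" where
  "UL \<beta> \<mu> k n =
     (THE P. real_polynomial_function P \<and> (\<forall>x t. \<bar>x\<bar> < t \<longrightarrow> P (x, t) = U_formula \<beta> \<mu> k n x t))"

definition VL :: "real \<Rightarrow> real \<Rightarrow> nat \<Rightarrow> nat \<Rightarrow> real \<times> real \<Rightarrow> real" where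
  "VL \<beta> \<mu> k n =
     (THE P. P \<in> orth_polys \<beta> \<mu> n \<and>
        (\<lambda>(x, t). P (x, t) - t ^ (n - k) * x ^ k) \<in> poly_deg_less n)"

definition c_coeff :: "real \<Rightarrow> real \<Rightarrow> nat \<Rightarrow> nat \<Rightarrow> nat \<Rightarrow> real" where
  "c_coeff \<beta> \<mu> n i k =
     fact k * pochhammer (\<mu> + real i + real n - real k + 1) i
     / (2 ^ (2 * i) * fact (k - 2 * i) * fact i
        * pochhammer (\<mu> + real n - real k + 1/2) (2 * i)
        * pochhammer (2 * \<mu> + \<beta> + 2 * real n - real k + 1) (2 * i))"

text \<open>
  The recursion is indexed by \<open>m = n - k\<close>, so \<open>k = n - m\<close>. For \<open>k \<le> 1\<close> the sum is empty and
  \<open>YL \<beta> \<mu> m n = UL \<beta> \<mu> m n\<close>. Only \<open>m \<le> n\<close> is meaningful.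
\<close>

function YL :: "real \<Rightarrow> real \<Rightarrow> nat \<Rightarrow> nat \<Rightarrow> real \<times> real \<Rightarrow> real" where
  "YL \<beta> \<mu> m n =
     (\<lambda>z. UL \<beta> \<mu> m n z
        - (\<Sum>i = 1..(n - m) div 2. c_coeff \<beta> \<mu> n i (n - m) * YL \<beta> \<mu> (m + 2 * i) n z))"
  by pat_completeness auto
termination
  by (relation "Wellfounded.measure (\<lambda>(\<beta>, \<mu>, m, n). n - m)") auto

declare YL.simps [simp del]

end

theory Submission
  imports Defs
begin

text \<open>
  In the coordinates \<open>u = x / t\<close> and \<open>t\<close> the weight on the cone factors into a Gegenbauer weight
  \<open>(1 - u^2) powr (\<mu> - 1/2)\<close> on \<open>[-1, 1]\<close> and a Laguerre weight in \<open>t\<close>, and the Rodrigues formula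
  factors accordingly. Integrating by parts in both variables, \<open>U\<^sub>k\<close> is orthogonal to all
  polynomials of degree below \<open>n\<close>, and its inner product with \<open>e\<^sub>j = x^j t^(n - j)\<close> vanishes unless
  \<open>j - k\<close> is even and nonnegative. So the matrix of these products is triangular, and the recursion
  for \<open>Y\<close> is the elimination that makes it diagonal: the coefficients are the ratios of an
  off-diagonal entry to the diagonal entry of the same column. Since \<open>V\<^sub>j\<close> differs from \<open>e\<^sub>j\<close>
  by a polynomial of degree below \<open>n\<close>, the families \<open>Y\<close> and \<open>V\<close> are biorthogonal, and
  positive definiteness of the inner product turns biorthogonality into the two basis claims.
\<close>

section \<open>Gegenbauer and Laguerre functionals\<close>

text \<open>Only the symmetric Jacobi case, the Gegenbauer weight, occurs. Extension by zero lets
  every integral run over the whole line, so substitution and Fubini need no bookkeeping of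
  domains.\<close>

definition jacobi_weight :: "real \<Rightarrow> real \<Rightarrow> real" where
  "jacobi_weight l u = (if \<bar>u\<bar> \<le> 1 then (1 - u\<^sup>2) powr l else 0)"

definition laguerre_weight :: "real \<Rightarrow> real \<Rightarrow> real" where
  "laguerre_weight s t = (if t > 0 then t powr s * exp (- t) else 0)"

definition jacobi_int :: "real \<Rightarrow> real poly \<Rightarrow> real" where
  "jacobi_int l p = (LINT u|lborel. poly p u * jacobi_weight l u)"

definition laguerre_int :: "real \<Rightarrow> real poly \<Rightarrow> real" where
  "laguerre_int s p = (LINT t|lborel. poly p t * laguerre_weight s t)"

lemma jacobi_weight_nonneg: "jacobi_weight l u \<ge> 0"
  by (simp add: jacobi_weight_def)

lemma measurable_jacobi_weight [measurable]: "jacobi_weight l \<in> borel_measurable borel"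
  unfolding jacobi_weight_def by measurable

lemma measurable_laguerre_weight [measurable]: "laguerre_weight s \<in> borel_measurable borel"
  unfolding laguerre_weight_def by measurable

lemma measurable_poly [measurable]: "poly p \<in> borel_measurable (borel :: real measure)"
  by (intro borel_measurable_continuous_onI continuous_intros)

text \<open>The substitution \<open>u = 1 - 2 t\<close> turns \<open>1 - u^2\<close> into
  \<open>4 t (1 - t)\<close>, which gives a Beta integral with both parameters \<open>l + 1\<close>
  and the factor \<open>4 powr l\<close>.\<close>

lemma integrable_jacobi_weight:
  assumes "l > -1"
  shows "integrable lborel (jacobi_weight l)"
proof -
  have B: "integrable lborel (\<lambda>t. indicator {0..1} t *\<^sub>R (t powr (l + 1 - 1) * (1 - t) powr (l + 1 - 1)))"
    using integrable_Beta[of "l + 1" "l + 1"] assms unfolding set_integrable_def by simp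
  have "integrable lborel (\<lambda>u. 4 powr l * (\<lambda>t. indicator {0..1} t *\<^sub>R (t powr (l + 1 - 1) * (1 - t) powr (l + 1 - 1))) (1/2 + (-1/2) * u))"
    by (intro integrable_mult_right lborel_integrable_real_affine[OF B]) simp
  also have "(\<lambda>u. 4 powr l * (\<lambda>t. indicator {0..1} t *\<^sub>R (t powr (l + 1 - 1) * (1 - t) powr (l + 1 - 1))) (1/2 + (-1/2) * u)) = jacobi_weight l"
  proof
    fix u :: real
    show "4 powr l * (\<lambda>t. indicator {0..1} t *\<^sub>R (t powr (l + 1 - 1) * (1 - t) powr (l + 1 - 1))) (1/2 + (-1/2) * u) = jacobi_weight l u"
    proof (cases "\<bar>u\<bar> \<le> 1")
      case True
      have "1 - u\<^sup>2 = 4 * ((1/2 + (-1/2) * u) * (1 - (1/2 + (-1/2) * u)))"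
        by (simp add: power2_eq_square field_simps)
      also have "\<dots> powr l = 4 powr l * ((1/2 + (-1/2) * u) powr l * (1 - (1/2 + (-1/2) * u)) powr l)"
        using True by (simp add: powr_mult)
      finally show ?thesis
        using True by (auto simp: jacobi_weight_def indicator_def)
    next
      case False
      then have "1/2 + (-1/2) * u \<notin> {0..1}" by auto
      with False show ?thesis by (simp add: jacobi_weight_def)
    qed
  qed
  finally show ?thesis .
qed

lemma integrable_poly_jacobi_weight:
  assumes "l > -1"
  shows "integrable lborel (\<lambda>u. poly p u * jacobi_weight l u)"
proof -
  have "compact (poly p ` {-1..1::real})"
    by (intro compact_continuous_image continuous_intros) auto
  then obtain C where C: "\<And>u. u \<in> {-1..1} \<Longrightarrow> \<bar>poly p u\<bar> \<le> C"
    using compact_imp_bounded[of "poly p ` {-1..1}"] unfolding bounded_iff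
    by (metis imageI real_norm_def)
  show ?thesis
  proof (rule Bochner_Integration.integrable_bound)
    show "integrable lborel (\<lambda>u. C * jacobi_weight l u)"
      by (intro integrable_mult_right integrable_jacobi_weight assms)
    have "norm (poly p u * jacobi_weight l u) \<le> norm (C * jacobi_weight l u)" for u
    proof (cases "\<bar>u\<bar> \<le> 1")
      case True
      then have "\<bar>poly p u\<bar> \<le> \<bar>C\<bar>" using C[of u] by force
      then show ?thesis by (simp add: abs_mult mult_right_mono)
    qed (simp add: jacobi_weight_def)
    then show "AE u in lborel. norm (poly p u * jacobi_weight l u) \<le> norm (C * jacobi_weight l u)"
      by simp
  qed measurable
qed

lemma laguerre_monom:
  assumes "s > -1"
  shows "integrable lborel (\<lambda>t. t ^ i * laguerre_weight s t)"
    and "(LINT t|lborel. t ^ i * laguerre_weight s t) = Gamma (s + i + 1)"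
proof -
  have "has_bochner_integral lborel (\<lambda>t. t ^ i * laguerre_weight s t) (Gamma (s + i + 1))"
  proof (rule has_bochner_integral_nn_integral)
    have x: "s + i + 1 > 0" using assms by simp
    \<comment> \<open>At \<open>t = 0\<close> both sides are 0, because \<open>0 powr a = 0\<close>
      for every \<open>a\<close>.\<close>
    have eq: "t ^ i * laguerre_weight s t = indicator {0..} t * (t powr (s + i + 1 - 1) / exp t)" for t :: real
      by (auto simp: laguerre_weight_def powr_add powr_realpow exp_minus field_simps)
    show "(\<integral>\<^sup>+ t. ennreal (t ^ i * laguerre_weight s t) \<partial>lborel) = ennreal (Gamma (s + i + 1))"
      unfolding eq
      using nn_integral_has_integral_lebesgue[OF _ Gamma_integral_real[OF x]] by simp
    show "AE t in lborel. 0 \<le> t ^ i * laguerre_weight s t"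
      by (simp add: laguerre_weight_def)
    show "0 \<le> Gamma (s + i + 1)" using Gamma_real_pos[OF x] by simp
  qed measurable
  then show "integrable lborel (\<lambda>t. t ^ i * laguerre_weight s t)"
    "(LINT t|lborel. t ^ i * laguerre_weight s t) = Gamma (s + i + 1)"
    by (auto simp: has_bochner_integral_iff)
qed

lemma integrable_poly_laguerre_weight:
  assumes "s > -1"
  shows "integrable lborel (\<lambda>t. poly p t * laguerre_weight s t)"
  unfolding poly_altdef sum_distrib_right mult.assoc
  by (intro Bochner_Integration.integrable_sum integrable_mult_right laguerre_monom assms)

lemma laguerre_int_monom:
  assumes "s > -1"
  shows "laguerre_int s (monom c i) = c * Gamma (s + i + 1)"
  using laguerre_monom(2)[OF assms, of i] unfolding laguerre_int_def
  by (simp add: poly_monom mult.assoc)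

lemma jacobi_int_smult: "jacobi_int l (smult c p) = c * jacobi_int l p"
  unfolding jacobi_int_def by (simp add: mult.assoc)

lemma jacobi_int_diff: "l > -1 \<Longrightarrow> jacobi_int l (p - q) = jacobi_int l p - jacobi_int l q"
  unfolding jacobi_int_def
  by (simp add: left_diff_distrib integrable_poly_jacobi_weight)

lemma laguerre_int_add: "s > -1 \<Longrightarrow> laguerre_int s (p + q) = laguerre_int s p + laguerre_int s q"
  unfolding laguerre_int_def
  by (simp add: distrib_right integrable_poly_laguerre_weight)

lemma laguerre_int_0: "laguerre_int s 0 = 0"
  by (simp add: laguerre_int_def)

lemma jacobi_int_0: "jacobi_int s 0 = 0"
  by (simp add: jacobi_int_def)

lemma laguerre_int_shift: "laguerre_int s (monom 1 i * p) = laguerre_int (s + i) p"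
  unfolding laguerre_int_def
  by (intro Bochner_Integration.integral_cong)
     (auto simp: laguerre_weight_def poly_monom powr_add powr_realpow)

lemma jacobi_int_shift:
  assumes "l > 0"
  shows "jacobi_int l p = jacobi_int (l - 1) (p * [:1, 0, -1:])"
proof -
  have *: "(1 - u\<^sup>2) powr l = (1 - u\<^sup>2) powr (l - 1) * (1 - u\<^sup>2)" if "\<bar>u\<bar> \<le> 1" for u :: real
    using that powr_mult_base[of "1 - u\<^sup>2" "l - 1"] by (simp add: abs_square_le_1 mult.commute)
  have "poly p u * jacobi_weight l u = poly (p * [:1, 0, -1:]) u * jacobi_weight (l - 1) u" for u
  proof (cases "\<bar>u\<bar> \<le> 1")
    case True
    have "poly [:1, 0, -1:] u = 1 - u\<^sup>2" by (simp add: power2_eq_square)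
    then show ?thesis using True by (simp only: jacobi_weight_def *[OF True] poly_mult if_True mult_ac)
  qed (simp add: jacobi_weight_def)
  then show ?thesis
    unfolding jacobi_int_def by (intro Bochner_Integration.integral_cong) simp_all
qed

text \<open>The integrand is the derivative of \<open>p(u) (1 - u^2)^l\<close>.\<close>

lemma jacobi_int_total_derivative:
  assumes "l > 0"
  shows "jacobi_int (l - 1) (pderiv p * [:1, 0, -1:] - smult (2 * l) ([:0, 1:] * p)) = 0"
proof -
  define f' where "f' = (\<lambda>u. poly (pderiv p * [:1, 0, -1:] - smult (2 * l) ([:0, 1:] * p)) u * jacobi_weight (l - 1) u)"
  let ?f = "\<lambda>u::real. poly p u * (1 - u\<^sup>2) powr l"
  have int: "integrable lborel f'"
    unfolding f'_def by (rule integrable_poly_jacobi_weight) (use assms in simp)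
  have "(f' has_integral (?f 1 - ?f (-1))) {-1..1}"
  \<comment> \<open>For \<open>l < 1\<close> the derivative can blow up at the endpoints, so it is
    taken in the open interval only. The hypothesis \<open>l > 0\<close> gives continuity up to the
    endpoints, where the antiderivative vanishes.\<close>
  proof (rule fundamental_theorem_of_calculus_interior)
    show "continuous_on {-1..1} ?f"
      by (intro continuous_intros continuous_on_powr') (use assms in \<open>auto simp: abs_square_le_1\<close>)
    fix u :: real assume u: "u \<in> {-1<..<1}"
    then have pos: "1 - u\<^sup>2 > 0" by (simp add: abs_square_less_1 abs_less_iff)
    have e: "(1 - u\<^sup>2) powr l = (1 - u\<^sup>2) powr (l - 1) * (1 - u\<^sup>2)"
      using pos powr_mult_base[of "1 - u\<^sup>2" "l - 1"] by (simp add: mult.commute)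
    have "(?f has_real_derivative
        poly (pderiv p) u * (1 - u\<^sup>2) powr l + (l * (1 - u\<^sup>2) powr (l - 1) * (0 - 2 * u)) * poly p u) (at u)"
      using pos by (auto intro!: derivative_eq_intros poly_DERIV simp: field_simps)
    also have "poly (pderiv p) u * (1 - u\<^sup>2) powr l + (l * (1 - u\<^sup>2) powr (l - 1) * (0 - 2 * u)) * poly p u = f' u"
      unfolding e f'_def using u by (auto simp: jacobi_weight_def power2_eq_square algebra_simps)
    finally show "(?f has_vector_derivative f' u) (at u)"
      by (simp add: has_real_derivative_iff_has_vector_derivative)
  qed simp
  then have "(f' has_integral 0) {-1..1}" using assms by simp
  then have "(f' has_integral 0) UNIV"
    by (rule has_integral_on_superset) (auto simp: f'_def jacobi_weight_def)
  with has_integral_integral_lborel[OF int] have "integral\<^sup>L lborel f' = 0"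
    by (rule has_integral_unique)
  then show ?thesis by (simp add: jacobi_int_def f'_def)
qed

text \<open>The integrand is the derivative of \<open>p(t) t^s e^(-t)\<close>.\<close>

lemma laguerre_int_total_derivative:
  assumes "s > 0"
  shows "laguerre_int (s - 1) ([:0, 1:] * pderiv p + smult s p - [:0, 1:] * p) = 0"
  using assms
\<comment> \<open>Induction on the coefficients avoids a limit at infinity: writing the polynomial
  as \<open>a + t p\<close> leaves the constant \<open>a\<close>, settled by
  \<open>Gamma (s + 1) = s Gamma s\<close>, and a factor \<open>t\<close> that raises the exponent
  by one. Hence \<open>s\<close> is kept arbitrary.\<close>
proof (induction p arbitrary: s)
  case 0
  then show ?case by (simp add: laguerre_int_0)
next
  case (pCons a p)
  let ?D = "\<lambda>s p. [:0, 1:] * pderiv p + smult s p - [:0, 1:] * p :: real poly"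
  have "?D s (pCons a p) = (monom (s * a) 0 + monom (- a) 1) + monom 1 1 * ?D (s + 1) p"
    by (simp add: pderiv_pCons monom_altdef smult_add_left algebra_simps)
  also have "laguerre_int (s - 1) \<dots> = s * a * Gamma s - a * Gamma (s + 1) + laguerre_int s (?D (s + 1) p)"
    using pCons.prems by (simp only: laguerre_int_add laguerre_int_shift laguerre_int_monom) (simp add: add.commute)
  also have "laguerre_int s (?D (s + 1) p) = 0"
    using pCons.IH[of "s + 1"] pCons.prems by simp
  finally show ?case
    using Gamma_plus1[of s] pCons.prems by (simp only: nonpos_Ints_def) auto
qed

section \<open>Rodrigues formulas in one variable\<close>

text \<open>The polynomial factor in the \<open>k\<close>-th derivative of
  \<open>(1 - u^2)^l\<close>, the rest being \<open>(1 - u^2)^(l - k)\<close>; a Gegenbauer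
  polynomial up to normalization. The recursion is the product rule.\<close>

fun jacobi_rodrigues :: "real \<Rightarrow> nat \<Rightarrow> real poly" where
  "jacobi_rodrigues l 0 = 1"
| "jacobi_rodrigues l (Suc k) = pderiv (jacobi_rodrigues l k) * [:1, 0, -1:]
     - smult (2 * (l - real k)) ([:0, 1:] * jacobi_rodrigues l k)"

text \<open>The polynomial factor in the \<open>k\<close>-th derivative of
  \<open>t^s e^(-t)\<close>, the rest being \<open>t^(s - k) e^(-t)\<close>; it is \<open>k!\<close>
  times the Laguerre polynomial with parameter \<open>s - k\<close>.\<close>

fun laguerre_rodrigues :: "real \<Rightarrow> nat \<Rightarrow> real poly" where
  "laguerre_rodrigues s 0 = 1"
| "laguerre_rodrigues s (Suc k) = [:0, 1:] * pderiv (laguerre_rodrigues s k)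
     + smult (s - real k) (laguerre_rodrigues s k) - [:0, 1:] * laguerre_rodrigues s k"

lemma x_as_monom: "[:0, 1:] = monom 1 1"
  by (simp add: monom_Suc monom_0)

lemma degree_jacobi_rodrigues: "degree (jacobi_rodrigues l k) \<le> k"
proof (induction k)
  case (Suc k)
  let ?R = "jacobi_rodrigues l k"
  have "degree (pderiv ?R * [:1, 0, -1:]) \<le> Suc k"
  \<comment> \<open>Truncated subtraction in \<open>degree ?R - 1\<close> makes the general bound 2
    for constant \<open>?R\<close>, which is too large when \<open>k = 0\<close>.\<close>
  proof (cases "degree ?R = 0")
    case True
    then have "pderiv ?R = 0" by (simp add: pderiv_eq_0_iff)
    then show ?thesis by simp
  next
    case False
    have "degree (pderiv ?R * [:1, 0, -1:]) \<le> degree (pderiv ?R) + degree [:1, 0, -1::real:]"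
      by (rule degree_mult_le)
    then show ?thesis using Suc False by (simp add: degree_pderiv)
  qed
  moreover have "degree (smult (2 * (l - real k)) ([:0, 1:] * ?R)) \<le> Suc k"
    using Suc by (intro order.trans[OF degree_smult_le] order.trans[OF degree_mult_le]) simp
  ultimately show ?case
    by (simp only: jacobi_rodrigues.simps) (rule degree_diff_le)
qed simp

lemma degree_laguerre_rodrigues: "degree (laguerre_rodrigues s k) \<le> k"
proof (induction k)
  case (Suc k)
  let ?R = "laguerre_rodrigues s k"
  have "degree ([:0, 1:] * pderiv ?R) \<le> Suc k"
    using Suc by (intro order.trans[OF degree_mult_le]) (simp add: degree_pderiv)
  moreover have "degree (smult (s - real k) ?R) \<le> Suc k"
    using Suc by (intro order.trans[OF degree_smult_le]) simp
  moreover have "degree ([:0, 1:] * ?R) \<le> Suc k"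
    using Suc by (intro order.trans[OF degree_mult_le]) simp
  ultimately show ?case
    by (simp only: laguerre_rodrigues.simps) (intro degree_diff_le degree_add_le)
qed simp

text \<open>Integration by parts \<open>k\<close> times, one derivative moving from the weight to
  \<open>p\<close> per step. Each antiderivative carries a positive power of \<open>1 - u^2\<close>,
  so no boundary term arises.\<close>

lemma jacobi_int_rodrigues:
  assumes "l > real k - 1"
  shows "jacobi_int (l - real k) (p * jacobi_rodrigues l k) = (-1) ^ k * jacobi_int l ((pderiv ^^ k) p)"
  using assms
proof (induction k arbitrary: p)
  case (Suc k)
  let ?R = "jacobi_rodrigues l k"
  have pos: "l - real k > 0" using Suc.prems by simp
  \<comment> \<open>A total derivative, whose integral is 0, minus the term in which
    \<open>p\<close> is differentiated. The factor \<open>1 - u^2\<close> left there raises the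
    exponent from \<open>l - k - 1\<close> back to \<open>l - k\<close>, as the induction hypothesis
    requires.\<close>
  have eq: "p * jacobi_rodrigues l (Suc k) =
      (pderiv (p * ?R) * [:1, 0, -1:] - smult (2 * (l - real k)) ([:0, 1:] * (p * ?R)))
      - (pderiv p * ?R) * [:1, 0, -1:]"
    unfolding jacobi_rodrigues.simps pderiv_mult mult_smult_right[symmetric]
    by (simp only: algebra_simps mult_smult_right mult_smult_left)
  have "jacobi_int (l - real (Suc k)) (p * jacobi_rodrigues l (Suc k)) =
      jacobi_int (l - real k - 1) (p * jacobi_rodrigues l (Suc k))"
    by (simp add: algebra_simps)
  also have "\<dots> = - jacobi_int (l - real k - 1) ((pderiv p * ?R) * [:1, 0, -1:])"
    unfolding eq using pos jacobi_int_total_derivative[OF pos, of "p * ?R"]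
    by (subst jacobi_int_diff) simp_all
  also have "\<dots> = - jacobi_int (l - real k) (pderiv p * ?R)"
    using jacobi_int_shift[OF pos] by simp
  also have "\<dots> = (-1) ^ Suc k * jacobi_int l ((pderiv ^^ Suc k) p)"
    using Suc.IH[of "pderiv p"] Suc.prems by (simp add: funpow_swap1)
  finally show ?case .
qed simp

text \<open>The same argument for \<open>t^s e^(-t)\<close>; the leftover factor is now
  \<open>t\<close>, absorbed by \<open>laguerre_int_shift\<close>.\<close>

lemma laguerre_int_rodrigues:
  assumes "s > real k - 1"
  shows "laguerre_int (s - real k) (p * laguerre_rodrigues s k) = (-1) ^ k * laguerre_int s ((pderiv ^^ k) p)"
  using assms
proof (induction k arbitrary: p)
  case (Suc k)
  let ?R = "laguerre_rodrigues s k"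
  have pos: "s - real k > 0" using Suc.prems by simp
  have eq: "p * laguerre_rodrigues s (Suc k) =
      ([:0, 1:] * pderiv (p * ?R) + smult (s - real k) (p * ?R) - [:0, 1:] * (p * ?R))
      - monom 1 1 * (pderiv p * ?R)"
    unfolding laguerre_rodrigues.simps pderiv_mult mult_smult_right[symmetric] x_as_monom
    by (simp only: algebra_simps mult_smult_right mult_smult_left)
  have "laguerre_int (s - real (Suc k)) (p * laguerre_rodrigues s (Suc k)) =
      laguerre_int (s - real k - 1) (p * laguerre_rodrigues s (Suc k))"
    by (simp add: algebra_simps)
  also have "\<dots> = - laguerre_int (s - real k - 1) (monom 1 1 * (pderiv p * ?R))"
    unfolding eq using pos laguerre_int_total_derivative[OF pos, of "p * ?R"]
    unfolding laguerre_int_def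
    by (subst poly_diff, subst left_diff_distrib, subst Bochner_Integration.integral_diff)
       (simp_all add: integrable_poly_laguerre_weight del: poly_diff poly_mult poly_add)
  also have "\<dots> = - laguerre_int (s - real k) (pderiv p * ?R)"
    using laguerre_int_shift[of "s - real k - 1" 1] by simp
  also have "\<dots> = (-1) ^ Suc k * laguerre_int s ((pderiv ^^ Suc k) p)"
    using Suc.IH[of "pderiv p"] Suc.prems by (simp add: funpow_swap1)
  finally show ?case .
qed simp

section \<open>Moments of the Gegenbauer weight\<close>

text \<open>The derivative of \<open>u^(a + 1) (1 - u^2)^(l + 1)\<close> integrates to 0, and
  expanding it relates exactly two moments.\<close>

lemma jacobi_int_moment_step:
  assumes "l > -1"
  shows "jacobi_int l (monom 1 (a + 2)) = (real a + 1) / (real a + 2 * l + 3) * jacobi_int l (monom 1 a)"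
proof -
  have eq: "pderiv (monom 1 (a + 1)) * [:1, 0, -1:] - smult (2 * (l + 1)) ([:0, 1:] * monom 1 (a + 1))
     = smult (real a + 1) (monom 1 a) - smult (real a + 2 * l + 3) (monom 1 (a + 2))"
    by (intro poly_eq_poly_eq_iff[THEN iffD1] ext)
       (simp add: pderiv_monom poly_monom algebra_simps power2_eq_square)
  have "jacobi_int l (smult (real a + 1) (monom 1 a) - smult (real a + 2 * l + 3) (monom 1 (a + 2))) = 0"
    using jacobi_int_total_derivative[of "l + 1" "monom 1 (a + 1)"] assms unfolding eq by simp
  then have "(real a + 1) * jacobi_int l (monom 1 a) = (real a + 2 * l + 3) * jacobi_int l (monom 1 (a + 2))"
    using assms by (simp add: jacobi_int_diff jacobi_int_smult)
  moreover have "real a + 2 * l + 3 \<noteq> 0" using assms by linarith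
  ultimately show ?thesis by (simp add: field_simps)
qed

text \<open>The two-step recurrence propagates the vanishing of the first moment, whose integrand is
  up to a factor the derivative of \<open>(1 - u^2)^(l + 1)\<close>.\<close>

lemma jacobi_int_odd:
  assumes "l > -1" "odd a"
  shows "jacobi_int l (monom 1 a) = 0"
proof -
  have 1: "jacobi_int l (monom 1 1) = 0"
    using jacobi_int_total_derivative[of "l + 1" "1"] jacobi_int_diff[of l 0] assms
    by (simp add: x_as_monom jacobi_int_0 jacobi_int_smult del: smult_monom)
  have "jacobi_int l (monom 1 (2 * i + 1)) = 0" for i
  proof (induction i)
    case (Suc i)
    have "2 * Suc i + 1 = (2 * i + 1) + 2" by simp
    then show ?case using jacobi_int_moment_step[OF assms(1), of "2 * i + 1"] Suc by (simp only:)
  qed (use 1 in simp)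
  with assms(2) show ?thesis by (auto elim!: oddE)
qed

lemma jacobi_int_even:
  assumes "l > -1"
  shows "jacobi_int l (monom 1 (2 * i)) = pochhammer (1/2) i / pochhammer (l + 3/2) i * jacobi_int l 1"
proof (induction i)
  case (Suc i)
  have "2 * Suc i = 2 * i + 2" by simp
  then have "jacobi_int l (monom 1 (2 * Suc i)) =
      (real (2 * i) + 1) / (real (2 * i) + 2 * l + 3) * (pochhammer (1/2) i / pochhammer (l + 3/2) i * jacobi_int l 1)"
    using jacobi_int_moment_step[OF assms, of "2 * i"] Suc by (simp only:)
  moreover have "(real (2 * i) + 1) / (real (2 * i) + 2 * l + 3) = (1/2 + i) / (l + 3/2 + i)"
    using assms by (simp add: divide_simps) (simp add: algebra_simps)
  ultimately show ?case by (simp only: pochhammer_Suc) (simp add: mult_ac)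
qed (simp add: monom_0 flip: one_pCons)

text \<open>Raising the exponent \<open>m\<close> by one inserts \<open>1 - u^2\<close> into the
  integral; evaluating the second moment gives the factor
  \<open>(2 m + 2) / (2 m + 3)\<close>.\<close>

lemma jacobi_int_level:
  assumes "l > -1"
  shows "jacobi_int (l + real k) 1 = pochhammer (l + 1) k / pochhammer (l + 3/2) k * jacobi_int l 1"
proof (induction k)
  case (Suc k)
  define m where "m = l + real k"
  have m: "m > -1" using assms by (simp add: m_def)
  have "jacobi_int (m + 1) 1 = jacobi_int m (monom 1 (2 * 0) - monom 1 (2 * 1))"
    using jacobi_int_shift[of "m + 1" 1] m
    by (simp add: monom_altdef numeral_2_eq_2)
  also have "\<dots> = (1 - 1 / (2 * m + 3)) * jacobi_int m 1"
    using m by (simp only: jacobi_int_diff jacobi_int_even) (simp add: algebra_simps)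
  also have "1 - 1 / (2 * m + 3) = (l + 1 + k) / (l + 3/2 + k)"
    using m by (simp add: m_def divide_simps) (simp add: algebra_simps)
  finally have "jacobi_int (l + real (Suc k)) 1 = (l + 1 + k) / (l + 3/2 + k) * jacobi_int (l + k) 1"
    by (simp add: m_def algebra_simps)
  then show ?case unfolding Suc pochhammer_Suc by (simp add: mult_ac)
qed simp

lemma jacobi_int_1_pos:
  assumes "l > -1"
  shows "jacobi_int l 1 > 0"
proof -
  have "jacobi_int l 1 \<ge> 0"
    unfolding jacobi_int_def by (intro integral_nonneg_AE) (simp add: jacobi_weight_nonneg)
  moreover have "jacobi_int l 1 \<noteq> 0"
  proof
    assume "jacobi_int l 1 = 0"
    then have "AE u in lborel. jacobi_weight l u = 0"
      using integral_nonneg_eq_0_iff_AE[OF integrable_jacobi_weight[OF assms]]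
      by (simp add: jacobi_weight_nonneg jacobi_int_def)
    moreover have "jacobi_weight l u \<noteq> 0" if "u \<in> {-1<..<1}" for u
      using that by (auto simp: jacobi_weight_def abs_square_eq_1)
    ultimately have "AE u in lborel. u \<notin> {-1<..<1::real}" by (auto elim!: eventually_mono)
    then have "{-1<..<1::real} \<in> null_sets lborel"
      by (subst (asm) AE_iff_null_sets[symmetric]) auto
    then show False by (simp add: null_sets_def)
  qed
  ultimately show ?thesis by simp
qed

text \<open>The Gegenbauer half of \<open>c_coeff\<close>: a moment at exponent \<open>l\<close>
  against the total mass at exponent \<open>l + 2 i\<close>. It combines
  \<open>jacobi_int_even\<close> and \<open>jacobi_int_level\<close> with the duplication
  \<open>(2 i)! = 4^i (1/2)_i i!\<close> and the splitting of \<open>(l + 3/2)_(2 i)\<close> into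
  two blocks of length \<open>i\<close>.\<close>

lemma jacobi_int_ratio:
  assumes "l > -1"
  shows "jacobi_int l (monom 1 (2 * i)) =
    fact (2 * i) * pochhammer (l + 3/2 + real i) i
      / (2 ^ (2 * i) * fact i * pochhammer (l + 1) (2 * i)) * jacobi_int (l + real (2 * i)) 1"
proof -
  have pos: "pochhammer (l + 3/2) i > 0" "pochhammer (l + 1) (2 * i) > 0" "pochhammer (l + 3/2) (2 * i) > 0"
    using assms by (auto intro!: pochhammer_pos)
  have "pochhammer (l + 3/2) (2 * i) = pochhammer (l + 3/2) i * pochhammer (l + 3/2 + real i) i"
    using pochhammer_product'[of "l + 3/2" i i] by (simp add: mult_2)
  moreover have "(fact (2 * i) :: real) = 2 ^ (2 * i) * pochhammer (1/2) i * fact i"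
    by (rule fact_double)
  moreover have "pochhammer (l + 3/2 + real i) i > 0"
    using assms by (auto intro!: pochhammer_pos)
  ultimately show ?thesis
    unfolding jacobi_int_even[OF assms] jacobi_int_level[OF assms, of "2 * i"]
    using pos by (simp add: field_simps)
qed

section \<open>Higher derivatives in the Rodrigues formula\<close>

text \<open>The power of \<open>t\<close> comes from scaling by \<open>u = x / t\<close>: the
  function is homogeneous of degree \<open>2 l\<close> in \<open>y\<close> and \<open>t\<close>, and
  every derivative lowers the degree by one.\<close>

lemma higher_deriv_jacobi:
  assumes "\<bar>x\<bar> < t"
  shows "(deriv ^^ k) (\<lambda>y. (t\<^sup>2 - y\<^sup>2) powr l) x =
    t powr (2 * l - real k) * poly (jacobi_rodrigues l k) (x / t) * (1 - (x / t)\<^sup>2) powr (l - real k)"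
  using assms
proof (induction k arbitrary: x)
  case 0
  have t: "t > 0" using 0 by simp
  have "(t\<^sup>2 - x\<^sup>2) = t\<^sup>2 * (1 - (x / t)\<^sup>2)" using t by (simp add: field_simps)
  moreover have "(x / t)\<^sup>2 < 1" using 0 t by (simp add: abs_square_less_1)
  moreover have "t\<^sup>2 powr l = t powr (2 * l)" using t by (simp add: powr_powr flip: powr_numeral)
  ultimately show ?case using t by (simp add: powr_mult)
next
  case (Suc k)
  let ?R = "jacobi_rodrigues l k"
  let ?f = "\<lambda>y. t powr (2 * l - real k) * poly ?R (y / t) * (1 - (y / t)\<^sup>2) powr (l - real k)"
  have t: "t > 0" using Suc.prems by simp
  define u where "u = x / t"
  have u: "1 - u\<^sup>2 > 0" using Suc.prems t by (simp add: u_def abs_square_less_1)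
  \<comment> \<open>Equality at \<open>x\<close> alone would not pass through \<open>deriv\<close>;
    the induction hypothesis holds on a whole open interval around \<open>x\<close>.\<close>
  have ev: "eventually (\<lambda>y. (deriv ^^ k) (\<lambda>y. (t\<^sup>2 - y\<^sup>2) powr l) y = ?f y) (nhds x)"
  proof (rule eventually_nhds_in_open[THEN eventually_mono])
    show "open {-t<..<t}" "x \<in> {-t<..<t}" using Suc.prems by auto
  qed (use Suc.IH in auto)
  have e1: "(1 - u\<^sup>2) powr (l - real k) = (1 - u\<^sup>2) powr (l - real k - 1) * (1 - u\<^sup>2)"
    using u powr_mult_base[of "1 - u\<^sup>2" "l - real k - 1"] by (simp add: mult.commute)
  have e2: "t powr (2 * l - real k) / t = t powr (2 * l - real (Suc k))"
    using t by (simp add: powr_diff powr_add)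
  have "((\<lambda>y. poly ?R (y / t)) has_real_derivative poly (pderiv ?R) u * (1 / t)) (at x)"
    unfolding u_def by (rule DERIV_chain2[OF poly_DERIV]) (use t in \<open>auto intro!: derivative_eq_intros\<close>)
  moreover have "((\<lambda>y. (1 - (y / t)\<^sup>2) powr (l - real k)) has_real_derivative
      ((l - real k) * (1 - u\<^sup>2) powr (l - real k - 1)) * (- 2 * u * (1 / t))) (at x)"
    unfolding u_def by (rule DERIV_chain2[OF has_real_derivative_powr])
       (use t u in \<open>auto intro!: derivative_eq_intros simp: u_def\<close>)
  ultimately have "(?f has_real_derivative
      t powr (2 * l - real k) * (poly (pderiv ?R) u * (1 / t) * (1 - u\<^sup>2) powr (l - real k)
       + ((l - real k) * (1 - u\<^sup>2) powr (l - real k - 1)) * (- 2 * u * (1 / t)) * poly ?R u)) (at x)"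
    unfolding mult.assoc[of "t powr _"] 
    by (intro DERIV_cmult) (auto dest: DERIV_mult simp: u_def)
  then have "deriv ?f x = t powr (2 * l - real k) * (poly (pderiv ?R) u * (1 / t) * (1 - u\<^sup>2) powr (l - real k)
       + ((l - real k) * (1 - u\<^sup>2) powr (l - real k - 1)) * (- 2 * u * (1 / t)) * poly ?R u)"
    by (rule DERIV_imp_deriv)
  also have "\<dots> = t powr (2 * l - real k) / t * poly (jacobi_rodrigues l (Suc k)) u * (1 - u\<^sup>2) powr (l - real k - 1)"
    unfolding e1 by (simp add: algebra_simps power2_eq_square)
  finally show ?case
    using deriv_cong_ev[OF ev refl] unfolding e2 u_def by (simp add: algebra_simps)
qed

lemma higher_deriv_laguerre:
  assumes "t > 0"
  shows "(deriv ^^ k) (\<lambda>y. y powr s * exp (- y)) t =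
    poly (laguerre_rodrigues s k) t * t powr (s - real k) * exp (- t)"
  using assms
proof (induction k arbitrary: t)
  case (Suc k)
  let ?R = "laguerre_rodrigues s k"
  let ?f = "\<lambda>t. poly ?R t * t powr (s - real k) * exp (- t)"
  have ev: "eventually (\<lambda>y. (deriv ^^ k) (\<lambda>y. y powr s * exp (- y)) y = ?f y) (nhds t)"
  proof (rule eventually_nhds_in_open[THEN eventually_mono])
    show "open {0::real<..}" "t \<in> {0<..}" using Suc.prems by auto
  qed (use Suc.IH in auto)
  have e1: "t powr (s - real k) = t powr (s - real k - 1) * t"
    using Suc.prems powr_mult_base[of t "s - real k - 1"] by (simp add: mult.commute)
  have "(?f has_real_derivative (poly (pderiv ?R) t * t powr (s - real k)
       + (s - real k) * t powr (s - real k - 1) * poly ?R t) * exp (- t)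
       + (exp (- t) * (- 1)) * (poly ?R t * t powr (s - real k))) (at t)"
    using Suc.prems by (intro DERIV_mult poly_DERIV has_real_derivative_powr DERIV_fun_exp derivative_eq_intros) auto
  then have "deriv ?f t = (poly (pderiv ?R) t * t powr (s - real k)
       + (s - real k) * t powr (s - real k - 1) * poly ?R t) * exp (- t)
       + (exp (- t) * (- 1)) * (poly ?R t * t powr (s - real k))"
    by (rule DERIV_imp_deriv)
  also have "\<dots> = poly (laguerre_rodrigues s (Suc k)) t * t powr (s - real k - 1) * exp (- t)"
    unfolding e1 by (simp add: algebra_simps)
  finally show ?case
    using deriv_cong_ev[OF ev refl] by (simp add: algebra_simps)
qed simp

section \<open>Integration over the cone\<close>

text \<open>Substituting \<open>x = u t\<close> in each horizontal slice has Jacobian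
  \<open>t\<close>, which joins \<open>h\<close>. Integrability is assumed of \<open>t * h t\<close>
  only, since \<open>h\<close> itself may be too singular at the vertex.\<close>

lemma cone_integral:
  fixes f h :: "real \<Rightarrow> real"
  assumes f: "integrable lborel f" and h: "integrable lborel (\<lambda>t. t * h t)"
    and [measurable]: "h \<in> borel_measurable borel"
    and h0: "\<And>t. t \<le> 0 \<Longrightarrow> h t = 0"
  shows "integrable lborel (\<lambda>(x, t). f (x / t) * h t)"
    and "(LINT z|lborel. (case z of (x, t) \<Rightarrow> f (x / t) * h t)) = (LINT u|lborel. f u) * (LINT t|lborel. t * h t)"
proof -
  note [measurable] = borel_measurable_integrable[OF f]
  \<comment> \<open>The coordinates are swapped so that the inner integral in Fubini runs over
    \<open>x\<close> at fixed \<open>t\<close>.\<close>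
  let ?g = "\<lambda>(t, x). f (x / t) * h t"
  have aff: "integrable lborel (\<lambda>x. k (x / t)) \<and> (LINT x|lborel. k (x / t)) = t * (LINT u|lborel. k u)"
    if "t > 0" "integrable lborel k" for t and k :: "real \<Rightarrow> real"
    using that lborel_integrable_real_affine_iff[of "1 / t" k 0]
      lborel_integral_real_affine[of "1 / t" k 0] by simp
  \<comment> \<open>Stated for general \<open>k\<close> and \<open>w\<close> because it serves
    twice: with absolute values for the Fubini hypothesis, and with \<open>f\<close> and
    \<open>h\<close> for the value. For \<open>t \<le> 0\<close> everything is 0.\<close>
  have row: "integrable lborel (\<lambda>x. k (x / t) * w t) \<and> (LINT x|lborel. k (x / t) * w t) = (LINT u|lborel. k u) * (t * w t)"
    if "integrable lborel k" "\<And>t. t \<le> 0 \<Longrightarrow> w t = 0" for t and k w :: "real \<Rightarrow> real"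
    using aff[of t k] that by (cases "t > 0") auto
  have [measurable]: "?g \<in> borel_measurable (lborel \<Otimes>\<^sub>M lborel)"
    by measurable
  have int: "integrable (lborel \<Otimes>\<^sub>M lborel) ?g"
  proof (rule lborel_pair.Fubini_integrable)
    have "(LINT x|lborel. norm (?g (t, x))) = (LINT u|lborel. \<bar>f u\<bar>) * \<bar>t * h t\<bar>" for t
      using row[of "\<lambda>u. \<bar>f u\<bar>" "\<lambda>t. \<bar>h t\<bar>" t] f h0 by (cases "t > 0") (auto simp: abs_mult)
    then show "integrable lborel (\<lambda>t. LINT x|lborel. norm (?g (t, x)))"
      using h by (simp add: integrable_abs)
    show "AE t in lborel. integrable lborel (\<lambda>x. ?g (t, x))"
      using row[of f h] f h0 by simp
  qed measurable
  have "integrable (lborel \<Otimes>\<^sub>M lborel) (\<lambda>(x, t). ?g (t, x))"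
    using int by (rule lborel_pair.integrable_product_swap)
  then show "integrable lborel (\<lambda>(x, t). f (x / t) * h t)"
    by (simp add: lborel_prod)
  have "(LINT z|lborel. (case z of (x, t) \<Rightarrow> f (x / t) * h t)) = integral\<^sup>L (lborel \<Otimes>\<^sub>M lborel) ?g"
    by (subst lborel_pair.integral_product_swap[symmetric]) (measurable, simp add: lborel_prod split_beta)
  also have "\<dots> = (LINT t|lborel. LINT x|lborel. ?g (t, x))"
    using lborel_pair.integral_fst'[OF int] by simp
  also have "\<dots> = (LINT t|lborel. (LINT u|lborel. f u) * (t * h t))"
  proof (rule Bochner_Integration.integral_cong[OF refl])
    fix t
    have "integrable lborel (\<lambda>x. f (x / t) * h t) \<and> (LINT x|lborel. f (x / t) * h t) = (LINT u|lborel. f u) * (t * h t)"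
      by (rule row[OF f]) (rule h0)
    then show "(LINT x|lborel. ?g (t, x)) = (LINT u|lborel. f u) * (t * h t)" by simp
  qed
  finally show "(LINT z|lborel. (case z of (x, t) \<Rightarrow> f (x / t) * h t)) = (LINT u|lborel. f u) * (LINT t|lborel. t * h t)"
    by simp
qed

text \<open>With \<open>x = u t\<close> the factor \<open>(t^2 - x^2)^(\<mu> - 1/2)\<close>
  contributes \<open>t^(2 \<mu> - 1)\<close>, hence the Laguerre exponent. Both sides vanish at the
  vertex because \<open>0 powr a = 0\<close>, so the identity holds everywhere.\<close>

lemma W_on_cone:
  "indicator V2 (x, t) * W \<beta> \<mu> (x, t) = jacobi_weight (\<mu> - 1/2) (x / t) * laguerre_weight (2 * \<mu> + \<beta> - 1) t"
proof (cases "t > 0 \<and> \<bar>x\<bar> \<le> t")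
  case True
  then have "(t\<^sup>2 - x\<^sup>2) = t\<^sup>2 * (1 - (x / t)\<^sup>2)" by (simp add: field_simps)
  moreover have "(x / t)\<^sup>2 \<le> 1" using True by (simp add: abs_square_le_1)
  moreover have "t\<^sup>2 powr (\<mu> - 1/2) = t powr (2 * \<mu> - 1)"
    using True by (simp add: powr_powr algebra_simps flip: powr_numeral)
  ultimately have "(t\<^sup>2 - x\<^sup>2) powr (\<mu> - 1/2) = t powr (2 * \<mu> - 1) * (1 - (x / t)\<^sup>2) powr (\<mu> - 1/2)"
    using True by (simp add: powr_mult)
  then show ?thesis
    using True by (simp add: W_def V2_def jacobi_weight_def laguerre_weight_def algebra_simps flip: powr_add)
next
  case False
  then show ?thesis
    by (cases "t = 0") (auto simp: W_def V2_def jacobi_weight_def laguerre_weight_def)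
qed

lemma W_nonneg: "W \<beta> \<mu> z \<ge> 0" if "z \<in> V2"
  using that by (auto simp: W_def V2_def)

lemma W_pos: "W \<beta> \<mu> (x, t) > 0" if "\<bar>x\<bar> < t"
  using that abs_le_square_iff[of t x] by (auto simp: W_def)

lemma poly_eq_sum_atMost:
  fixes p :: "'a :: comm_semiring_1 poly"
  assumes "degree p \<le> m"
  shows "poly p x = (\<Sum>i\<le>m. coeff p i * x ^ i)"
  unfolding poly_altdef
  by (intro sum.mono_neutral_left) (use assms in \<open>auto simp: coeff_eq_0\<close>)

text \<open>This is \<open>t^m p(x / t)\<close>, written through coefficients so that it is a
  polynomial also at \<open>t = 0\<close>. Coefficients beyond \<open>m\<close> are dropped, so the
  reading requires \<open>degree p \<le> m\<close>.\<close>

definition homogenize :: "nat \<Rightarrow> real poly \<Rightarrow> real \<times> real \<Rightarrow> real" where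
  "homogenize m p = (\<lambda>(x, t). \<Sum>i\<le>m. coeff p i * x ^ i * t ^ (m - i))"

lemma homogenize_eq:
  assumes "degree p \<le> m" "t \<noteq> 0"
  shows "homogenize m p (x, t) = t ^ m * poly p (x / t)"
proof -
  have "homogenize m p (x, t) = (\<Sum>i\<le>m. t ^ m * (coeff p i * (x / t) ^ i))"
    unfolding homogenize_def using assms(2)
    by (auto intro!: sum.cong simp: power_diff field_simps)
  also have "\<dots> = t ^ m * (\<Sum>i\<le>m. coeff p i * (x / t) ^ i)"
    by (simp add: sum_distrib_left)
  also have "(\<Sum>i\<le>m. coeff p i * (x / t) ^ i) = poly p (x / t)"
    by (rule poly_eq_sum_atMost[OF assms(1), symmetric])
  finally show ?thesis .
qed

definition bimonom :: "nat \<Rightarrow> nat \<Rightarrow> real \<times> real \<Rightarrow> real" where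
  "bimonom i j = (\<lambda>(x, t). x ^ i * t ^ j)"

definition cone_product :: "nat \<Rightarrow> real poly \<Rightarrow> real poly \<Rightarrow> real \<times> real \<Rightarrow> real" where
  "cone_product m p q = (\<lambda>(x, t). homogenize m p (x, t) * poly q t)"

text \<open>In \<open>u\<close> and \<open>t\<close> the monomial is \<open>u^a t^(a + b)\<close>
  and the homogenization gives \<open>t^m p(u)\<close>, so the integrand separates. The Jacobian
  raises the Laguerre exponent from \<open>2 \<mu> + \<beta> - 1\<close> to
  \<open>2 \<mu> + \<beta>\<close>.\<close>

lemma cone_product_integral:
  assumes "\<mu> > - 1/2" "2 * \<mu> + \<beta> + 1 > 0" "degree p \<le> m"
  shows "set_integrable lborel V2 (\<lambda>z. cone_product m p q z * bimonom a b z * W \<beta> \<mu> z)"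
    and "W_inner \<beta> \<mu> (cone_product m p q) (bimonom a b) =
      jacobi_int (\<mu> - 1/2) (monom 1 a * p) * laguerre_int (2 * \<mu> + \<beta>) (monom 1 (m + a + b) * q)"
proof -
  define f where "f = (\<lambda>u. poly (monom 1 a * p) u * jacobi_weight (\<mu> - 1/2) u)"
  define h where "h = (\<lambda>t. poly (monom 1 (m + a + b) * q) t * laguerre_weight (2 * \<mu> + \<beta> - 1) t)"
  have th: "t * h t = poly (monom 1 (m + a + b) * q) t * laguerre_weight (2 * \<mu> + \<beta>) t" for t
    using powr_mult_base[of t "2 * \<mu> + \<beta> - 1"] by (auto simp: h_def laguerre_weight_def)
  have eq: "indicator V2 z * (cone_product m p q z * bimonom a b z * W \<beta> \<mu> z) =
      (case z of (x, t) \<Rightarrow> f (x / t) * h t)" for z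
  proof (cases z)
    case (Pair x t)
    have "indicator V2 (x, t) * (cone_product m p q (x, t) * bimonom a b (x, t) * W \<beta> \<mu> (x, t)) =
      (cone_product m p q (x, t) * bimonom a b (x, t)) * (indicator V2 (x, t) * W \<beta> \<mu> (x, t))" by simp
    also have "\<dots> = f (x / t) * h t"
    proof (cases "t > 0")
      case True
      then show ?thesis unfolding W_on_cone
        by (simp add: cone_product_def homogenize_eq[OF assms(3)] bimonom_def f_def h_def poly_monom
            power_add power_divide)
    qed (simp add: W_on_cone h_def laguerre_weight_def)
    finally show ?thesis using Pair by simp
  qed
  have f: "integrable lborel f"
    unfolding f_def using assms by (intro integrable_poly_jacobi_weight) simp
  have h: "integrable lborel (\<lambda>t. t * h t)"
    unfolding th using assms by (intro integrable_poly_laguerre_weight) simp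
  have hm: "h \<in> borel_measurable borel" unfolding h_def by measurable
  have h0: "h t = 0" if "t \<le> 0" for t using that by (simp add: h_def laguerre_weight_def)
  note ci = cone_integral[OF f h hm h0]
  show "set_integrable lborel V2 (\<lambda>z. cone_product m p q z * bimonom a b z * W \<beta> \<mu> z)"
    unfolding set_integrable_def real_scaleR_def eq by (rule ci(1))
  show "W_inner \<beta> \<mu> (cone_product m p q) (bimonom a b) =
      jacobi_int (\<mu> - 1/2) (monom 1 a * p) * laguerre_int (2 * \<mu> + \<beta>) (monom 1 (m + a + b) * q)"
    using ci(2) unfolding W_inner_def set_lebesgue_integral_def real_scaleR_def eq
    by (simp only: jacobi_int_def laguerre_int_def th flip: f_def)
qed

section \<open>Integrability of polynomials and positive definiteness\<close>

text \<open>Since \<open>|x| \<le> t\<close> on the cone, growth is controlled by \<open>t\<close>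
  alone; this supplies the dominating function for integrability.\<close>

lemma real_polynomial_bound_on_cone:
  assumes "real_polynomial_function P"
  shows "\<exists>C N. \<forall>z \<in> V2. \<bar>P z\<bar> \<le> C * (1 + snd z) ^ N"
  using assms
proof (induction rule: real_polynomial_function.induct)
  case (linear f)
  then obtain K where K: "\<And>z. norm (f z) \<le> norm z * K" and "K > 0"
    using bounded_linear.pos_bounded by blast
  have "\<bar>f z\<bar> \<le> (2 * K) * (1 + snd z) ^ 1" if "z \<in> V2" for z
  proof -
    have "norm z \<le> \<bar>fst z\<bar> + \<bar>snd z\<bar>"
      using norm_Pair_le[of "fst z" "snd z"] by simp
    also have "\<dots> \<le> 2 * (1 + snd z)" using that by (auto simp: V2_def)
    finally have "norm z * K \<le> 2 * (1 + snd z) * K" using \<open>K > 0\<close> by (intro mult_right_mono) auto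
    then show ?thesis using K[of z] by (simp add: mult_ac)
  qed
  then show ?case by blast
next
  case (const c)
  have "\<bar>c\<bar> \<le> \<bar>c\<bar> * (1 + snd z) ^ 0" for z :: "real \<times> real" by simp
  then show ?case by blast
next
  case (add f g)
  then obtain C N D M where f: "\<And>z. z \<in> V2 \<Longrightarrow> \<bar>f z\<bar> \<le> C * (1 + snd z) ^ N"
    and g: "\<And>z. z \<in> V2 \<Longrightarrow> \<bar>g z\<bar> \<le> D * (1 + snd z) ^ M" by metis
  have "\<bar>f z + g z\<bar> \<le> (\<bar>C\<bar> + \<bar>D\<bar>) * (1 + snd z) ^ (N + M)" if "z \<in> V2" for z
  proof -
    have t: "snd z \<ge> 0" using that by (auto simp: V2_def)
    have "C * (1 + snd z) ^ N \<le> \<bar>C\<bar> * (1 + snd z) ^ (N + M)"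
      using t by (intro mult_mono power_increasing) auto
    moreover have "D * (1 + snd z) ^ M \<le> \<bar>D\<bar> * (1 + snd z) ^ (N + M)"
      using t by (intro mult_mono power_increasing) auto
    ultimately show ?thesis using f[OF that] g[OF that] by (simp add: distrib_right)
  qed
  then show ?case by blast
next
  case (mult f g)
  then obtain C N D M where f: "\<And>z. z \<in> V2 \<Longrightarrow> \<bar>f z\<bar> \<le> C * (1 + snd z) ^ N"
    and g: "\<And>z. z \<in> V2 \<Longrightarrow> \<bar>g z\<bar> \<le> D * (1 + snd z) ^ M" by metis
  have "\<bar>f z * g z\<bar> \<le> (C * D) * (1 + snd z) ^ (N + M)" if "z \<in> V2" for z
    using mult_mono[OF f[OF that] g[OF that]] order.trans[OF abs_ge_zero f[OF that]]
    by (simp add: abs_mult power_add mult_ac)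
  then show ?case by blast
qed

lemma measurable_real_polynomial:
  fixes P :: "'a::euclidean_space \<Rightarrow> real"
  assumes "real_polynomial_function P"
  shows "P \<in> borel_measurable borel"
  using continuous_polymonial_function[of P] assms
  by (intro borel_measurable_continuous_onI continuous_at_imp_continuous_on)
     (simp add: real_polynomial_function_eq)

lemma closed_V2: "closed V2"
proof -
  have eq: "V2 = {z. \<bar>fst z\<bar> \<le> snd z} \<inter> {z. snd z \<ge> 0}" by (auto simp: V2_def)
  show ?thesis unfolding eq by (intro closed_Int closed_Collect_le continuous_intros)
qed

lemma measurable_W: "W \<beta> \<mu> \<in> borel_measurable borel"
proof -
  have "W \<beta> \<mu> = (\<lambda>z. ((snd z)\<^sup>2 - (fst z)\<^sup>2) powr (\<mu> - 1/2) * snd z powr \<beta> * exp (- snd z))"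
    by (auto simp: W_def)
  also have "\<dots> \<in> borel_measurable (borel \<Otimes>\<^sub>M borel)" by measurable
  finally show ?thesis by (simp add: borel_prod)
qed

lemma real_polynomial_integrable:
  assumes "\<mu> > - 1/2" "2 * \<mu> + \<beta> + 1 > 0" "real_polynomial_function P"
  shows "set_integrable lborel V2 (\<lambda>z. P z * W \<beta> \<mu> z)"
proof -
  obtain C N where CN: "\<And>z. z \<in> V2 \<Longrightarrow> \<bar>P z\<bar> \<le> C * (1 + snd z) ^ N"
    using real_polynomial_bound_on_cone[OF assms(3)] by blast
  have [measurable]: "P \<in> borel_measurable borel" "W \<beta> \<mu> \<in> borel_measurable borel" "V2 \<in> sets borel"
    using measurable_real_polynomial[OF assms(3)] measurable_W closed_V2 by (auto intro: borel_closed)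
  \<comment> \<open>The dominating function \<open>C (1 + t)^N\<close>, expressed as a cone product
    with trivial factor in \<open>x / t\<close>.\<close>
  have "set_integrable lborel V2 (\<lambda>z. cone_product 0 [:C:] ([:1, 1:] ^ N) z * bimonom 0 0 z * W \<beta> \<mu> z)"
    using assms by (intro cone_product_integral) auto
  then show ?thesis
    unfolding set_integrable_def
  proof (rule Bochner_Integration.integrable_bound)
    have "norm (indicat_real V2 z *\<^sub>R (P z * W \<beta> \<mu> z))
         \<le> norm (indicat_real V2 z *\<^sub>R (cone_product 0 [:C:] ([:1, 1:] ^ N) z * bimonom 0 0 z * W \<beta> \<mu> z))" for z
    proof (cases "z \<in> V2")
      case True
      obtain x t where z: "z = (x, t)" by (cases z)
      have "cone_product 0 [:C:] ([:1, 1:] ^ N) z * bimonom 0 0 z = C * (1 + snd z) ^ N"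
        by (simp add: cone_product_def homogenize_def bimonom_def z)
      moreover have "\<bar>P z\<bar> * \<bar>W \<beta> \<mu> z\<bar> \<le> \<bar>C * (1 + snd z) ^ N\<bar> * \<bar>W \<beta> \<mu> z\<bar>"
        using order.trans[OF CN[OF True] abs_ge_self] by (rule mult_right_mono) simp
      ultimately show ?thesis using True by (simp add: abs_mult)
    qed simp
    then show "AE z in lborel. norm (indicat_real V2 z *\<^sub>R (P z * W \<beta> \<mu> z))
         \<le> norm (indicat_real V2 z *\<^sub>R (cone_product 0 [:C:] ([:1, 1:] ^ N) z * bimonom 0 0 z * W \<beta> \<mu> z))"
      by simp
  qed measurable
qed

text \<open>On each vertical line the restriction is a univariate polynomial that vanishes on a ray
  inside the cone, hence identically. Thus the Rodrigues formula, meaningful only inside the cone,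
  determines \<open>UL\<close>.\<close>

lemma real_polynomial_zero_on_cone:
  fixes P :: "real \<times> real \<Rightarrow> real"
  assumes "real_polynomial_function P" "\<And>x t. \<bar>x\<bar> < t \<Longrightarrow> P (x, t) = 0"
  shows "P = (\<lambda>_. 0)"
proof (rule ext, clarify)
  fix x t :: real
  have "polynomial_function (\<lambda>r::real. (x, t + r))"
    using polynomial_function_add[OF polynomial_function_const[of "(x, t)"]
        polynomial_function_bounded_linear[OF bounded_linear_scaleR_left[of "(0, 1 :: real)"]]]
    by simp
  then have "real_polynomial_function (P \<circ> (\<lambda>r::real. (x, t + r)))"
    using assms(1) by (rule real_polynomial_function_compose)
  then obtain a n where an: "P \<circ> (\<lambda>r::real. (x, t + r)) = (\<lambda>r. \<Sum>i\<le>n. a i * r ^ i)"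
    using real_polynomial_function_imp_sum by blast
  have sub: "{\<bar>x\<bar> - t <..} \<subseteq> {r. (\<Sum>i\<le>n. a i * r ^ i) = 0}"
    using assms(2)[of x "t + _"] fun_cong[OF an] by force
  have "\<forall>i\<le>n. a i = 0"
  proof (rule ccontr)
    assume "\<not> (\<forall>i\<le>n. a i = 0)"
    then have "finite {r. (\<Sum>i\<le>n. a i * r ^ i) = 0}"
      by (subst polyfun_finite_roots) blast
    with sub have "finite {\<bar>x\<bar> - t <..}" by (rule finite_subset)
    then show False by (simp add: infinite_Ioi)
  qed
  then show "P (x, t) = 0" using fun_cong[OF an, of 0] by simp
qed

text \<open>The weight is positive inside the cone, so \<open>P\<close> vanishes there almost
  everywhere. The set of interior points with \<open>P\<close> nonzero is then open and null, hence
  empty.\<close>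

lemma W_inner_definite:
  assumes "\<mu> > - 1/2" "2 * \<mu> + \<beta> + 1 > 0" "real_polynomial_function P" "W_inner \<beta> \<mu> P P = 0"
  shows "P = (\<lambda>_. 0)"
proof (rule real_polynomial_zero_on_cone[OF assms(3)])
  have PP: "real_polynomial_function (\<lambda>z. P z * P z)"
    using assms(3) assms(3) by (rule real_polynomial_function.intros)
  have "AE z in lborel. indicator V2 z *\<^sub>R (P z * P z * W \<beta> \<mu> z) = 0"
    using real_polynomial_integrable[OF assms(1,2) PP] assms(4)
    unfolding set_integrable_def W_inner_def set_lebesgue_integral_def
    by (subst (asm) integral_nonneg_eq_0_iff_AE) (auto simp: indicator_def W_nonneg)
  then have AE: "AE z in lborel. z \<notin> {z. \<bar>fst z\<bar> < snd z} \<inter> P -` (- {0})"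
  proof (rule eventually_mono)
    fix z assume *: "indicator V2 z *\<^sub>R (P z * P z * W \<beta> \<mu> z) = 0"
    show "z \<notin> {z. \<bar>fst z\<bar> < snd z} \<inter> P -` (- {0})"
    proof (cases z)
      case (Pair x t)
      then show ?thesis using * W_pos[of x t \<beta> \<mu>] by (auto simp: V2_def indicator_def split: if_splits)
    qed
  qed
  have "continuous_on UNIV P"
    using continuous_polymonial_function[of P] assms(3)
    by (intro continuous_at_imp_continuous_on) (simp add: real_polynomial_function_eq)
  then have op: "open ({z. \<bar>fst z\<bar> < snd z} \<inter> P -` (- {0}))"
    by (intro open_Int open_Collect_less open_vimage continuous_intros) auto
  have "{z. \<bar>fst z\<bar> < snd z} \<inter> P -` (- {0}) \<in> null_sets lborel"
    using AE op by (subst (asm) AE_iff_null_sets[symmetric]) auto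
  then have "negligible ({z. \<bar>fst z\<bar> < snd z} \<inter> P -` (- {0}))"
    by (simp add: negligible_iff_null_sets null_sets_completionI)
  with op have "{z. \<bar>fst z\<bar> < snd z} \<inter> P -` (- {0}) = {}"
    using open_not_negligible by blast
  then have "(x, t) \<notin> {z. \<bar>fst z\<bar> < snd z} \<inter> P -` (- {0})" for x t
    by simp
  then show "P (x, t) = 0" if "\<bar>x\<bar> < t" for x t
    using that by simp
qed

section \<open>Orthogonal polynomials on the cone\<close>

lemma fscale_apply: "fscale c f z = c * f z"
  by (simp add: fscale_def)

lemma sum_fun_apply: "(\<Sum>i\<in>A. f i) z = (\<Sum>i\<in>A. (f i z :: real))" for f :: "'i \<Rightarrow> real \<times> real \<Rightarrow> real"
  by (induction A rule: infinite_finite_induct) auto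

lemma poly_deg_less_bimonom: "poly_deg_less m = fvs.span {bimonom i j | i j. i + j < m}"
  by (simp add: poly_deg_less_def bimonom_def)

lemma bimonom_in_poly_deg_less: "i + j < m \<Longrightarrow> bimonom i j \<in> poly_deg_less m"
  unfolding poly_deg_less_bimonom by (intro fvs.span_base) blast

lemma subspace_poly_deg_less: "fvs.subspace (poly_deg_less m)"
  unfolding poly_deg_less_def by (rule fvs.subspace_span)

lemma poly_deg_less_mono: "m \<le> n \<Longrightarrow> poly_deg_less m \<subseteq> poly_deg_less n"
  unfolding poly_deg_less_bimonom by (intro fvs.span_mono) (use less_le_trans in blast)

lemma real_polynomial_bimonom: "real_polynomial_function (bimonom i j)"
proof -
  have "bimonom i j = (\<lambda>z. fst z ^ i * snd z ^ j)" by (auto simp: bimonom_def)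
  then show ?thesis
    by (simp only:) (intro real_polynomial_function.intros(4) real_polynomial_function_power
        real_polynomial_function.intros(1) bounded_linear_fst bounded_linear_snd)
qed

lemma real_polynomial_plus:
  "real_polynomial_function P \<Longrightarrow> real_polynomial_function Q \<Longrightarrow> real_polynomial_function (P + Q)"
  unfolding func_plus by (rule real_polynomial_function.intros(3))

lemma real_polynomial_fscale:
  "real_polynomial_function P \<Longrightarrow> real_polynomial_function (fscale c P)"
  unfolding fscale_def by (rule real_polynomial_function.intros(4)[OF real_polynomial_function.intros(2)])

lemma subspace_real_polynomial: "fvs.subspace (Collect real_polynomial_function)"
  unfolding fvs.subspace_def
  using real_polynomial_function.intros(2)[of 0] by (simp add: real_polynomial_plus real_polynomial_fscale func_zero)

lemma poly_deg_less_imp_real_polynomial: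
  "P \<in> poly_deg_less m \<Longrightarrow> real_polynomial_function P"
  unfolding poly_deg_less_bimonom
  by (drule subsetD[OF fvs.span_minimal[OF _ subspace_real_polynomial], rotated])
     (auto intro: real_polynomial_bimonom)

lemma W_inner_commute: "W_inner \<beta> \<mu> P Q = W_inner \<beta> \<mu> Q P"
  unfolding W_inner_def by (simp add: mult.commute)

lemma W_inner_fscale: "W_inner \<beta> \<mu> (fscale c P) Q = c * W_inner \<beta> \<mu> P Q"
  unfolding W_inner_def by (simp add: fscale_apply mult.assoc)

lemma higher_pderiv_monom_real:
  "k \<le> a \<Longrightarrow> (pderiv ^^ k) (monom c a) = monom (fact a / fact (a - k) * c :: real) (a - k)"
proof (induction k)
  case (Suc k)
  have *: "fact (a - k) = real (a - k) * fact (a - Suc k)"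
    using Suc.prems by (subst fact_reduce) auto
  have "(pderiv ^^ Suc k) (monom c a) = monom (real (a - k) * (fact a / fact (a - k) * c)) (a - Suc k)"
    using Suc by (simp add: pderiv_monom)
  also have "real (a - k) * (fact a / fact (a - k) * c) = fact a / fact (a - Suc k) * c"
    unfolding * using Suc.prems by (simp del: of_nat_diff)
  finally show ?case .
qed simp

lemma higher_pderiv_monom_zero:
  "a < k \<Longrightarrow> (pderiv ^^ k) (monom c a) = (0 :: real poly)"
proof (induction k)
  case (Suc k)
  then show ?case by (cases "a = k") (auto simp: higher_pderiv_monom_real pderiv_monom)
qed simp

section \<open>Algebra of the inner product\<close>

text \<open>The inequalities say that the Gegenbauer exponent \<open>\<mu> - 1/2\<close> and the
  Laguerre exponent \<open>2 \<mu> + \<beta>\<close> exceed -1, which makes polynomials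
  integrable.\<close>

locale laguerre_cone =
  fixes \<beta> \<mu> :: real
  assumes mu: "\<mu> > - 1/2" and mu_beta: "2 * \<mu> + \<beta> + 1 > 0"
begin

abbreviation inner_W (infix "\<star>" 70) where "P \<star> Q \<equiv> W_inner \<beta> \<mu> P Q"

lemma W_inner_add:
  assumes "real_polynomial_function P" "real_polynomial_function Q" "real_polynomial_function R"
  shows "(P + Q) \<star> R = P \<star> R + Q \<star> R"
proof -
  have PR: "real_polynomial_function (\<lambda>z. P z * R z)" and QR: "real_polynomial_function (\<lambda>z. Q z * R z)"
    using assms by (auto intro: real_polynomial_function.intros)
  show ?thesis
    using set_integral_add(2)[OF real_polynomial_integrable[OF mu mu_beta PR] real_polynomial_integrable[OF mu mu_beta QR]]
    unfolding W_inner_def by (simp add: algebra_simps)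
qed

lemma W_inner_sum:
  assumes "\<And>i. i \<in> A \<Longrightarrow> real_polynomial_function (f i)" "real_polynomial_function R"
  shows "(\<Sum>i\<in>A. fscale (c i) (f i)) \<star> R = (\<Sum>i\<in>A. c i * (f i \<star> R))"
    and "real_polynomial_function (\<Sum>i\<in>A. fscale (c i) (f i))"
proof -
  have "real_polynomial_function (\<Sum>i\<in>A. fscale (c i) (f i)) \<and>
    (\<Sum>i\<in>A. fscale (c i) (f i)) \<star> R = (\<Sum>i\<in>A. c i * (f i \<star> R))"
    using assms(1)
  proof (induction A rule: infinite_finite_induct)
    case (insert x F)
    then show ?case
      using assms(2) by (simp add: W_inner_add W_inner_fscale real_polynomial_plus real_polynomial_fscale del: plus_fun_apply)
  qed (use W_inner_fscale[of \<beta> \<mu> 0 0 R] real_polynomial_function.intros(2)[of 0] in \<open>auto simp: zero_fun_def fscale_def\<close>)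
  then show "(\<Sum>i\<in>A. fscale (c i) (f i)) \<star> R = (\<Sum>i\<in>A. c i * (f i \<star> R))"
    and "real_polynomial_function (\<Sum>i\<in>A. fscale (c i) (f i))" by auto
qed

lemma W_inner_diff:
  assumes "real_polynomial_function P" "real_polynomial_function Q" "real_polynomial_function R"
  shows "(P - Q) \<star> R = P \<star> R - Q \<star> R" "real_polynomial_function (P - Q)"
proof -
  have "P - Q = P + fscale (-1) Q" by (simp add: fun_eq_iff fscale_apply)
  then show "(P - Q) \<star> R = P \<star> R - Q \<star> R" "real_polynomial_function (P - Q)"
    using assms by (simp_all only: W_inner_add W_inner_fscale real_polynomial_plus real_polynomial_fscale)
qed

lemma W_inner_zero: "(0 :: real \<times> real \<Rightarrow> real) \<star> R = 0"
  by (simp add: W_inner_def)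

text \<open>Polynomiality belongs to the set because additivity of the inner product rests on
  integrability.\<close>

lemma subspace_orthogonal:
  assumes "real_polynomial_function P"
  shows "fvs.subspace {Q. real_polynomial_function Q \<and> Q \<star> P = 0}"
  using subspace_real_polynomial assms
  by (auto simp: fvs.subspace_def W_inner_add W_inner_fscale W_inner_zero)

lemma orthogonal_span:
  assumes "real_polynomial_function P" "\<And>Q. Q \<in> S \<Longrightarrow> real_polynomial_function Q \<and> Q \<star> P = 0"
    and "Q \<in> fvs.span S"
  shows "Q \<star> P = 0"
  using fvs.span_minimal[OF _ subspace_orthogonal[OF assms(1)], of S] assms(2,3) by blast

lemma orthogonal_poly_deg_less:
  assumes "real_polynomial_function P" "\<And>i j. i + j < m \<Longrightarrow> P \<star> bimonom i j = 0"
    and "Q \<in> poly_deg_less m"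
  shows "P \<star> Q = 0"
  using assms(3) unfolding poly_deg_less_bimonom W_inner_commute[of \<beta> \<mu> P]
  by (rule orthogonal_span[OF assms(1), rotated])
     (use assms(2) real_polynomial_bimonom W_inner_commute in auto)

lemma definite:
  "real_polynomial_function P \<Longrightarrow> P \<star> P = 0 \<Longrightarrow> P = 0"
  using W_inner_definite[OF mu mu_beta] by (auto simp: zero_fun_def)

lemma orth_polysD:
  assumes "P \<in> orth_polys \<beta> \<mu> n"
  shows "real_polynomial_function P" "P \<in> poly_deg_less (Suc n)" "Q \<in> poly_deg_less n \<Longrightarrow> P \<star> Q = 0"
  using assms poly_deg_less_imp_real_polynomial by (auto simp: orth_polys_def)

lemma subspace_orth_polys: "fvs.subspace (orth_polys \<beta> \<mu> n)"
  using subspace_poly_deg_less[of "Suc n"]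
  by (auto simp: fvs.subspace_def orth_polys_def W_inner_add W_inner_fscale W_inner_zero
      poly_deg_less_imp_real_polynomial)

section \<open>Bases from biorthogonality, and orthogonal projection\<close>

text \<open>Pairing a linear combination with \<open>G j\<close> isolates its \<open>j\<close>-th
  coefficient, which gives independence. For spanning, the expansion of \<open>P\<close> with
  coefficients \<open>(P \<star> G i) / (F i \<star> G i)\<close> leaves a remainder orthogonal to
  all \<open>G j\<close>, which \<open>total\<close> forces to be 0. No dimension count enters, and
  \<open>G\<close> may lie outside \<open>S\<close>.\<close>

lemma biorthogonal_imp_indexed_basis:
  fixes I :: "'i set"
  assumes "finite I" and S: "fvs.subspace S" "S \<subseteq> Collect real_polynomial_function"
    and F: "\<And>i. i \<in> I \<Longrightarrow> F i \<in> S" and G: "\<And>i. i \<in> I \<Longrightarrow> real_polynomial_function (G i)"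
    and zero: "\<And>i j. i \<in> I \<Longrightarrow> j \<in> I \<Longrightarrow> i \<noteq> j \<Longrightarrow> F i \<star> G j = 0"
    and nz: "\<And>i. i \<in> I \<Longrightarrow> F i \<star> G i \<noteq> 0"
    and total: "\<And>Q. Q \<in> S \<Longrightarrow> (\<And>j. j \<in> I \<Longrightarrow> Q \<star> G j = 0) \<Longrightarrow> Q = 0"
  shows "indexed_basis I F S"
proof -
  have Fp: "real_polynomial_function (F i)" if "i \<in> I" for i using F[OF that] S(2) by auto
  have inj: "inj_on F I"
    using zero nz by (intro inj_onI) metis
  have coord: "(\<Sum>i\<in>I. fscale (c i) (F i)) \<star> G j = c j * (F j \<star> G j)" if "j \<in> I" for c j
  proof -
    have "(\<Sum>i\<in>I. fscale (c i) (F i)) \<star> G j = (\<Sum>i\<in>I. c i * (F i \<star> G j))"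
      using Fp G that by (intro W_inner_sum) auto
    also have "\<dots> = (\<Sum>i\<in>I. if i = j then c j * (F j \<star> G j) else 0)"
      using zero that by (intro sum.cong) auto
    finally show ?thesis using \<open>finite I\<close> that by simp
  qed
  have "fvs.independent (F ` I)"
  proof
    assume "fvs.dependent (F ` I)"
    then obtain u v where u: "v \<in> F ` I" "u v \<noteq> 0" "(\<Sum>v\<in>F ` I. fscale (u v) v) = 0"
      using \<open>finite I\<close> by (auto simp: fvs.dependent_finite)
    then obtain j where j: "j \<in> I" "v = F j" by auto
    have "(\<Sum>i\<in>I. fscale (u (F i)) (F i)) = 0"
      using u(3) by (simp add: sum.reindex[OF inj])
    then show False
      using coord[OF j(1), of "\<lambda>i. u (F i)"] nz[OF j(1)] u(2) j(2) by (simp add: W_inner_zero)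
  qed
  moreover have "fvs.span (F ` I) = S"
  proof
    show "fvs.span (F ` I) \<subseteq> S" using F S(1) by (intro fvs.span_minimal) auto
    show "S \<subseteq> fvs.span (F ` I)"
    proof
      fix P assume P: "P \<in> S"
      let ?R = "\<Sum>i\<in>I. fscale ((P \<star> G i) / (F i \<star> G i)) (F i)"
      have R: "?R \<in> fvs.span (F ` I)"
        by (intro fvs.span_sum fvs.span_scale fvs.span_base) auto
      then have RS: "?R \<in> S" using \<open>fvs.span (F ` I) \<subseteq> S\<close> by auto
      have "P - ?R = 0"
      proof (rule total)
        show "P - ?R \<in> S" using P RS S(1) by (rule fvs.subspace_diff[rotated])
        fix j assume j: "j \<in> I"
        show "(P - ?R) \<star> G j = 0"
          using P RS S(2) G[OF j] coord[OF j] nz[OF j] by (subst W_inner_diff) auto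
      qed
      then show "P \<in> fvs.span (F ` I)" using R by simp
    qed
  qed
  ultimately show ?thesis using inj by (simp add: indexed_basis_def)
qed

text \<open>Gram-Schmidt by induction on \<open>S\<close>. The induction keeps \<open>f\<close>
  arbitrary because its hypothesis is applied to \<open>f\<close> and to the new element
  \<open>a\<close>; the part of \<open>a\<close> orthogonal to \<open>S\<close> then corrects the
  projection of \<open>f\<close>.\<close>

lemma orthogonal_projection:
  assumes "finite S" "S \<subseteq> Collect real_polynomial_function" "real_polynomial_function f"
  shows "\<exists>q \<in> fvs.span S. \<forall>s \<in> S. (f - q) \<star> s = 0"
  using assms
proof (induction S arbitrary: f rule: finite_induct)
  case empty
  then show ?case by auto
next
  case (insert a S)
  have sp: "real_polynomial_function q" if "q \<in> fvs.span S" for q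
    using fvs.span_minimal[OF _ subspace_real_polynomial, of S] insert.prems that by auto
  have a: "real_polynomial_function a" using insert.prems by simp
  obtain q where q: "q \<in> fvs.span S" "\<And>s. s \<in> S \<Longrightarrow> (f - q) \<star> s = 0"
    using insert.IH[of f] insert.prems by blast
  obtain r where r: "r \<in> fvs.span S" "\<And>s. s \<in> S \<Longrightarrow> (a - r) \<star> s = 0"
    using insert.IH[of a] insert.prems by blast
  define b where "b = a - r"
  \<comment> \<open>If \<open>b \<star> b = 0\<close>, then \<open>c = 0\<close> by division by
    zero, and definiteness gives \<open>b = 0\<close>, so there is nothing to correct.\<close>
  define c where "c = ((f - q) \<star> b) / (b \<star> b)"
  let ?q = "q + fscale c b"
  have b: "real_polynomial_function b" unfolding b_def using a sp[OF r(1)] by (intro W_inner_diff)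
  have fq: "real_polynomial_function (f - q)" using insert.prems sp[OF q(1)] by (intro W_inner_diff) auto
  have split: "(f - ?q) \<star> s = (f - q) \<star> s - c * (b \<star> s)" if "real_polynomial_function s" for s
  proof -
    have "f - ?q = (f - q) - fscale c b" by (rule diff_diff_add[symmetric])
    then show ?thesis
      using W_inner_diff(1)[OF fq real_polynomial_fscale[OF b] that, of c] by (simp only: W_inner_fscale)
  qed
  have fq': "real_polynomial_function (f - ?q)"
    using insert.prems sp[OF q(1)] b by (intro W_inner_diff real_polynomial_plus real_polynomial_fscale) auto
  have onS: "(f - ?q) \<star> s = 0" if "s \<in> S" for s
    using split[of s] that q(2) r(2) insert.prems by (auto simp: b_def)
  have onb: "(f - ?q) \<star> b = 0"
  proof (cases "b \<star> b = 0")
    case True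
    then have "b = 0" using definite[OF b] by simp
    then have "b \<star> (f - ?q) = 0" using W_inner_zero by (simp only:)
    then show ?thesis by (subst W_inner_commute)
  next
    case False
    then show ?thesis using split[OF b] by (simp add: c_def)
  qed
  have onr: "r \<star> (f - ?q) = 0"
    using fq' r(1) onS insert.prems
    by (intro orthogonal_span[of _ S]) (auto simp: W_inner_commute[of \<beta> \<mu> _ "f - ?q"])
  have "a = b + r" by (simp add: b_def)
  then have "(f - ?q) \<star> a = 0"
    using W_inner_add[OF b sp[OF r(1)] fq'] onr onb by (simp add: W_inner_commute[of \<beta> \<mu> "f - ?q"])
  moreover have "?q \<in> fvs.span (insert a S)"
  proof -
    have "fvs.span S \<subseteq> fvs.span (insert a S)" by (intro fvs.span_mono) auto
    then have "q \<in> fvs.span (insert a S)" "r \<in> fvs.span (insert a S)" using q(1) r(1) by auto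
    then show ?thesis
      unfolding b_def by (intro fvs.span_add fvs.span_scale fvs.span_diff) (simp_all add: fvs.span_base)
  qed
  ultimately show ?case using onS by blast
qed

text \<open>Existence: subtract from the leading monomial its projection onto the polynomials of
  degree below \<open>n\<close>. Uniqueness: the difference of two candidates has degree below
  \<open>n\<close> and is orthogonal to all such polynomials, hence to itself.\<close>

lemma VL_props:
  assumes "k \<le> n"
  shows "VL \<beta> \<mu> k n \<in> orth_polys \<beta> \<mu> n" "VL \<beta> \<mu> k n - bimonom k (n - k) \<in> poly_deg_less n"
proof -
  let ?e = "bimonom k (n - k)"
  let ?prop = "\<lambda>P. P \<in> orth_polys \<beta> \<mu> n \<and> P - ?e \<in> poly_deg_less n"
  have e: "?e \<in> poly_deg_less (Suc n)" using assms by (intro bimonom_in_poly_deg_less) simp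
  have "{bimonom i j | i j. i + j < n} \<subseteq> (\<lambda>(i, j). bimonom i j) ` ({..n} \<times> {..n})" by force
  then have fin: "finite {bimonom i j | i j. i + j < n}" by (rule finite_subset) simp
  obtain q where q: "q \<in> poly_deg_less n" "\<And>i j. i + j < n \<Longrightarrow> (?e - q) \<star> bimonom i j = 0"
  proof -
    have "{bimonom i j | i j. i + j < n} \<subseteq> Collect real_polynomial_function"
      using real_polynomial_bimonom by blast
    from orthogonal_projection[OF fin this real_polynomial_bimonom[of k "n - k"]]
    show ?thesis using that unfolding poly_deg_less_bimonom by blast
  qed
  have 1: "?prop (?e - q)"
  proof
    have "?e - q \<in> poly_deg_less (Suc n)"
      using e q(1) poly_deg_less_mono[of n "Suc n"] by (intro fvs.subspace_diff[OF subspace_poly_deg_less]) auto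
    moreover from this have "real_polynomial_function (?e - q)" by (rule poly_deg_less_imp_real_polynomial)
    then have "\<forall>Q\<in>poly_deg_less n. (?e - q) \<star> Q = 0"
      using q(2) by (blast intro: orthogonal_poly_deg_less)
    ultimately show "?e - q \<in> orth_polys \<beta> \<mu> n" unfolding orth_polys_def by blast
    have "?e - q - ?e = fscale (-1) q" by (simp add: fun_eq_iff fscale_apply)
    then show "?e - q - ?e \<in> poly_deg_less n"
      by (simp only:) (rule fvs.subspace_scale[OF subspace_poly_deg_less q(1)])
  qed
  have 2: "P = Q" if "?prop P" "?prop Q" for P Q
  proof -
    have "(P - ?e) - (Q - ?e) \<in> poly_deg_less n"
      using that by (blast intro: fvs.subspace_diff[OF subspace_poly_deg_less])
    then have D: "P - Q \<in> poly_deg_less n" by simp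
    have "P - Q \<in> orth_polys \<beta> \<mu> n"
      using that by (intro fvs.subspace_diff[OF subspace_orth_polys]) auto
    then have "P - Q = 0" using D orth_polysD definite by blast
    then show ?thesis by simp
  qed
  have eq: "(\<lambda>(x, t). P (x, t) - t ^ (n - k) * x ^ k) = P - ?e" for P
    by (auto simp: bimonom_def fun_eq_iff)
  have "?prop (VL \<beta> \<mu> k n)"
    unfolding VL_def eq by (rule theI'[of ?prop]) (use 1 2 in blast)
  then show "VL \<beta> \<mu> k n \<in> orth_polys \<beta> \<mu> n" "VL \<beta> \<mu> k n - ?e \<in> poly_deg_less n" by auto
qed

section \<open>Explicit form and pairings of the polynomials \<open>U\<close>\<close>

text \<open>What the Rodrigues formula leaves after cancelling the weight: \<open>t^k\<close> times
  a Gegenbauer factor in \<open>x / t\<close>, times a Laguerre factor in \<open>t\<close>.\<close>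

definition U_poly :: "nat \<Rightarrow> nat \<Rightarrow> real \<times> real \<Rightarrow> real" where
  "U_poly k n = cone_product k (jacobi_rodrigues (real k + \<mu> - 1/2) k)
     (laguerre_rodrigues (real n + real k + \<beta> + 2 * \<mu>) (n - k))"

lemma U_poly_degree:
  assumes "k \<le> n"
  shows "U_poly k n \<in> poly_deg_less (Suc n)"
proof -
  define p where "p = jacobi_rodrigues (real k + \<mu> - 1/2) k"
  define q where "q = laguerre_rodrigues (real n + real k + \<beta> + 2 * \<mu>) (n - k)"
  have "degree q \<le> n - k" unfolding q_def by (rule degree_laguerre_rodrigues)
  then have q: "poly q t = (\<Sum>j\<le>n - k. coeff q j * t ^ j)" for t
    by (rule poly_eq_sum_atMost)
  have "U_poly k n = (\<Sum>i\<le>k. \<Sum>j\<le>n - k. fscale (coeff p i * coeff q j) (bimonom i (k - i + j)))"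
  proof (rule ext, clarify)
    fix x t
    show "U_poly k n (x, t) = (\<Sum>i\<le>k. \<Sum>j\<le>n - k. fscale (coeff p i * coeff q j) (bimonom i (k - i + j))) (x, t)"
      unfolding U_poly_def p_def[symmetric] q_def[symmetric] cone_product_def homogenize_def prod.case q
      by (simp add: sum_fun_apply fscale_apply sum_product bimonom_def) (intro sum.cong refl, simp add: mult_ac add.commute flip: power_add)
  qed
  also have "\<dots> \<in> poly_deg_less (Suc n)"
    using assms by (intro fvs.subspace_sum fvs.subspace_scale subspace_poly_deg_less bimonom_in_poly_deg_less) auto
  finally show ?thesis .
qed

lemma U_poly_formula:
  assumes "k \<le> n" "\<bar>x\<bar> < t"
  shows "U_poly k n (x, t) = U_formula \<beta> \<mu> k n x t"
proof -
  define l where "l = real k + \<mu> - 1/2"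
  define s where "s = real n + real k + \<beta> + 2 * \<mu>"
  define w where "w = (1 - (x / t)\<^sup>2) powr (\<mu> - 1/2)"
  have t: "t > 0" using assms by simp
  have "(x / t)\<^sup>2 < 1" using assms t by (simp add: abs_square_less_1)
  then have w: "w > 0" by (simp add: w_def)
  have W: "W \<beta> \<mu> (x, t) = w * (t powr (2 * \<mu> + \<beta> - 1) * exp (- t))"
    using W_on_cone[of x t \<beta> \<mu>] assms t by (simp add: V2_def jacobi_weight_def laguerre_weight_def w_def)
  have D1: "(deriv ^^ k) (\<lambda>y. (t\<^sup>2 - y\<^sup>2) powr (real k + \<mu> - 1/2)) x =
      t powr (real k + 2 * \<mu> - 1) * poly (jacobi_rodrigues l k) (x / t) * w"
    using higher_deriv_jacobi[OF assms(2), of k l] by (simp add: l_def w_def algebra_simps)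
  have D2: "(deriv ^^ (n - k)) (\<lambda>y. y powr (real n + real k + \<beta> + 2 * \<mu>) * exp (- y)) t =
      poly (laguerre_rodrigues s (n - k)) t * t powr (2 * real k + \<beta> + 2 * \<mu>) * exp (- t)"
    using higher_deriv_laguerre[OF t, of "n - k" s] assms(1) by (simp add: s_def of_nat_diff algebra_simps)
  \<comment> \<open>Both sides have total exponent \<open>3 k + 4 \<mu> + \<beta> - 1\<close>. The
    surplus \<open>t^k\<close> is exactly what homogenizes a polynomial of degree \<open>k\<close>
    in \<open>x / t\<close>.\<close>
  have P: "t powr (real k + 2 * \<mu> - 1) * t powr (2 * real k + \<beta> + 2 * \<mu>) =
      t ^ k * (t powr (2 * \<mu> + \<beta> - 1) * t powr (2 * real k + 2 * \<mu>))"
    using t by (simp add: powr_realpow[symmetric] flip: powr_add)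
  have "U_formula \<beta> \<mu> k n x t = 
      (t powr (real k + 2 * \<mu> - 1) * t powr (2 * real k + \<beta> + 2 * \<mu>))
       / (t powr (2 * \<mu> + \<beta> - 1) * t powr (2 * real k + 2 * \<mu>))
      * poly (jacobi_rodrigues l k) (x / t) * poly (laguerre_rodrigues s (n - k)) t"
    unfolding U_formula_def D1 D2 W using w by (simp add: field_simps)
  also have "\<dots> = t ^ k * poly (jacobi_rodrigues l k) (x / t) * poly (laguerre_rodrigues s (n - k)) t"
    unfolding P using t by simp
  also have "\<dots> = U_poly k n (x, t)"
    unfolding U_poly_def cone_product_def using t
    by (simp add: homogenize_eq degree_jacobi_rodrigues l_def s_def)
  finally show ?thesis by simp
qed

lemma UL_eq:
  assumes "k \<le> n"
  shows "UL \<beta> \<mu> k n = U_poly k n"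
  unfolding UL_def
proof (rule the_equality)
  have U: "real_polynomial_function (U_poly k n)"
    using U_poly_degree[OF assms] by (rule poly_deg_less_imp_real_polynomial)
  show "real_polynomial_function (U_poly k n) \<and> (\<forall>x t. \<bar>x\<bar> < t \<longrightarrow> U_poly k n (x, t) = U_formula \<beta> \<mu> k n x t)"
    using U U_poly_formula[OF assms] by auto
  fix P assume P: "real_polynomial_function P \<and> (\<forall>x t. \<bar>x\<bar> < t \<longrightarrow> P (x, t) = U_formula \<beta> \<mu> k n x t)"
  have "P - U_poly k n = (\<lambda>_. 0)"
    using P U U_poly_formula[OF assms]
    by (intro real_polynomial_zero_on_cone W_inner_diff) auto
  then show "P = U_poly k n" by (simp add: fun_eq_iff)
qed

text \<open>After integration by parts, \<open>k\<close> derivatives fall on \<open>u^a\<close> and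
  \<open>n - k\<close> derivatives on \<open>t^(a + b - k)\<close>. The first result is 0 for
  \<open>a < k\<close>, the second for \<open>a + b < n\<close>; at \<open>a + b = n\<close> the
  constant \<open>(n - k)!\<close> remains.\<close>

lemma U_poly_inner:
  assumes "k \<le> n" "a + b \<le> n"
  shows "U_poly k n \<star> bimonom a b =
    (if k \<le> a \<and> a + b = n
     then (-1) ^ n * (fact a / fact (a - k)) * jacobi_int (real k + \<mu> - 1/2) (monom 1 (a - k))
       * fact (n - k) * Gamma (real n + real k + \<beta> + 2 * \<mu> + 1)
     else 0)"
proof -
  define l where "l = real k + \<mu> - 1/2"
  define s where "s = real n + real k + \<beta> + 2 * \<mu>"
  have "U_poly k n \<star> bimonom a b = jacobi_int (l - real k) (monom 1 a * jacobi_rodrigues l k)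
     * laguerre_int (2 * \<mu> + \<beta>) (monom 1 (k + a + b) * laguerre_rodrigues s (n - k))"
    unfolding U_poly_def by (subst cone_product_integral(2)[OF mu mu_beta degree_jacobi_rodrigues])
      (simp add: l_def s_def)
  also have "jacobi_int (l - real k) (monom 1 a * jacobi_rodrigues l k) =
      (-1) ^ k * jacobi_int l ((pderiv ^^ k) (monom 1 a))"
    by (rule jacobi_int_rodrigues) (use mu in \<open>simp add: l_def\<close>)
  finally have 1: "U_poly k n \<star> bimonom a b = (-1) ^ k * jacobi_int l ((pderiv ^^ k) (monom 1 a))
     * laguerre_int (2 * \<mu> + \<beta>) (monom 1 (k + a + b) * laguerre_rodrigues s (n - k))" .
  show ?thesis
  proof (cases "k \<le> a")
    case False
    then show ?thesis using 1 by (simp add: higher_pderiv_monom_zero jacobi_int_0)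
  next
    case True
    \<comment> \<open>Moving \<open>t^(2 k)\<close> into the weight produces the exponent
      \<open>s - (n - k)\<close> that \<open>laguerre_int_rodrigues\<close> asks for.\<close>
    have "monom 1 (k + a + b) = monom 1 (2 * k) * (monom 1 (a + b - k) :: real poly)"
      using True by (simp add: mult_monom add_ac)
    then have "laguerre_int (2 * \<mu> + \<beta>) (monom 1 (k + a + b) * laguerre_rodrigues s (n - k)) =
        laguerre_int (2 * \<mu> + \<beta> + real (2 * k)) (monom 1 (a + b - k) * laguerre_rodrigues s (n - k))"
      by (simp only: mult.assoc laguerre_int_shift)
    also have "2 * \<mu> + \<beta> + real (2 * k) = s - real (n - k)"
      using assms by (simp add: s_def of_nat_diff)
    also have "laguerre_int (s - real (n - k)) (monom 1 (a + b - k) * laguerre_rodrigues s (n - k)) =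
        (-1) ^ (n - k) * laguerre_int s ((pderiv ^^ (n - k)) (monom 1 (a + b - k)))"
      by (rule laguerre_int_rodrigues) (use mu_beta assms in \<open>simp add: s_def of_nat_diff\<close>)
    also have "\<dots> = (if a + b = n then (-1) ^ (n - k) * fact (n - k) * Gamma (s + 1) else 0)"
    proof (cases "a + b = n")
      case True
      have "s > -1" using mu_beta by (simp add: s_def)
      then show ?thesis using True assms(1) laguerre_int_monom[of s "fact (n - k)" 0]
        by (simp add: higher_pderiv_monom_real)
    next
      case False
      then have "a + b - k < n - k" using assms True by linarith
      then show ?thesis using False by (simp add: higher_pderiv_monom_zero laguerre_int_0)
    qed
    finally have 2: "laguerre_int (2 * \<mu> + \<beta>) (monom 1 (k + a + b) * laguerre_rodrigues s (n - k)) =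
        (if a + b = n then (-1) ^ (n - k) * fact (n - k) * Gamma (s + 1) else 0)" .
    have 3: "jacobi_int l ((pderiv ^^ k) (monom 1 a)) = fact a / fact (a - k) * jacobi_int l (monom 1 (a - k))"
      using True jacobi_int_smult[of l "fact a / fact (a - k)" "monom 1 (a - k)"]
      by (simp add: higher_pderiv_monom_real smult_monom)
    have 4: "(-1) ^ n = (-1) ^ k * ((-1) ^ (n - k) :: real)"
      using assms(1) by (simp flip: power_add)
    show ?thesis
      unfolding 1 2 3 4 using True by (simp add: l_def s_def mult_ac)
  qed
qed

lemma U_poly_orth:
  assumes "k \<le> n"
  shows "U_poly k n \<in> orth_polys \<beta> \<mu> n"
proof -
  have "real_polynomial_function (U_poly k n)"
    using U_poly_degree[OF assms] by (rule poly_deg_less_imp_real_polynomial)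
  moreover have "U_poly k n \<star> bimonom i j = 0" if "i + j < n" for i j
    using U_poly_inner[OF assms, of i j] that by simp
  ultimately have "\<forall>Q\<in>poly_deg_less n. U_poly k n \<star> Q = 0"
    by (blast intro: orthogonal_poly_deg_less)
  then show ?thesis
    using U_poly_degree[OF assms] unfolding orth_polys_def by blast
qed

lemma U_poly_inner_diag:
  assumes "k \<le> n"
  shows "U_poly k n \<star> bimonom k (n - k) \<noteq> 0"
proof -
  have "jacobi_int (real k + \<mu> - 1/2) 1 > 0"
    using mu by (intro jacobi_int_1_pos) simp
  moreover have "Gamma (real n + real k + \<beta> + 2 * \<mu> + 1) > 0"
    using mu_beta by (intro Gamma_real_pos) simp
  ultimately show ?thesis
    using assms by (simp add: U_poly_inner monom_0 flip: one_pCons)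
qed

text \<open>The coefficients \<open>c\<^sub>i\<^sub>,\<^sub>k\<close> are the multipliers of the triangular elimination.\<close>

lemma U_poly_inner_off_diag:
  assumes "k + 2 * i \<le> n"
  shows "U_poly k n \<star> bimonom (k + 2 * i) (n - (k + 2 * i)) =
    c_coeff \<beta> \<mu> n i (n - k) * (U_poly (k + 2 * i) n \<star> bimonom (k + 2 * i) (n - (k + 2 * i)))"
proof -
  define j where "j = k + 2 * i"
  define l where "l = real k + \<mu> - 1/2"
  define s where "s = real n + real k + \<beta> + 2 * \<mu>"
  have l: "l > -1" and s: "s + 1 > 0" using mu mu_beta by (simp_all add: l_def s_def)
  have "s + 1 \<notin> \<int>\<^sub>\<le>\<^sub>0" using s by (auto elim!: nonpos_Ints_cases)
  \<comment> \<open>The Laguerre half of the coefficient: this Pochhammer symbol is the last factor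
    in the denominator of \<open>c_coeff\<close>.\<close>
  then have G: "Gamma (s + 1 + real (2 * i)) = pochhammer (s + 1) (2 * i) * Gamma (s + 1)"
    using pochhammer_Gamma[of "s + 1" "2 * i"] Gamma_real_pos[OF s] by simp
  have pos: "pochhammer (s + 1) (2 * i) > 0" "pochhammer (l + 1) (2 * i) > 0"
    using l s by (auto intro!: pochhammer_pos)
  \<comment> \<open>The last index of \<open>c_coeff\<close> counts down from \<open>n\<close>, so
    it is \<open>n - k\<close> here; the three Pochhammer bases become \<open>l + 3/2 + i\<close>,
    \<open>l + 1\<close> and \<open>s + 1\<close>.\<close>
  have c: "c_coeff \<beta> \<mu> n i (n - k) = fact (n - k) * pochhammer (l + 3/2 + real i) i
      / (2 ^ (2 * i) * fact (n - j) * fact i * pochhammer (l + 1) (2 * i) * pochhammer (s + 1) (2 * i))"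
  proof -
    have "\<mu> + real i + real n - real (n - k) + 1 = l + 3/2 + real i"
      "\<mu> + real n - real (n - k) + 1/2 = l + 1"
      "2 * \<mu> + \<beta> + 2 * real n - real (n - k) + 1 = s + 1"
      "n - k - 2 * i = n - j"
      using assms by (simp_all add: l_def s_def j_def of_nat_diff)
    then show ?thesis by (simp only: c_coeff_def)
  qed
  have e: "real j + \<mu> - 1/2 = l + real (2 * i)" "real n + real j + \<beta> + 2 * \<mu> + 1 = s + 1 + real (2 * i)"
    "real k + \<mu> - 1/2 = l" "real n + real k + \<beta> + 2 * \<mu> + 1 = s + 1"
    by (simp_all add: j_def l_def s_def)
  have A: "U_poly k n \<star> bimonom j (n - j) =
      (-1) ^ n * (fact j / fact (2 * i)) * jacobi_int l (monom 1 (2 * i)) * fact (n - k) * Gamma (s + 1)"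
    using assms U_poly_inner[of k n j "n - j"] unfolding e by (simp add: j_def)
  have B: "U_poly j n \<star> bimonom j (n - j) =
      (-1) ^ n * fact j * jacobi_int (l + real (2 * i)) 1 * fact (n - j) * (pochhammer (s + 1) (2 * i) * Gamma (s + 1))"
    using assms U_poly_inner[of j n j "n - j"] unfolding e G by (simp add: j_def monom_0 flip: one_pCons)
  show ?thesis
    unfolding j_def[symmetric] A B c jacobi_int_ratio[OF l] using pos by (simp add: field_simps)
qed

section \<open>The polynomials \<open>Y\<close>, biorthogonality and the two bases\<close>

lemma YL_eq: "YL \<beta> \<mu> m n = UL \<beta> \<mu> m n - (\<Sum>i = 1..(n - m) div 2. fscale (c_coeff \<beta> \<mu> n i (n - m)) (YL \<beta> \<mu> (m + 2 * i) n))"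
  by (rule ext, subst YL.simps) (simp add: sum_fun_apply fscale_apply)

text \<open>Induction runs downwards from \<open>m = n\<close>. By hypothesis each \<open>Y\<close>
  in the sum pairs only with its own monomial, so the term with \<open>m + 2 i = j\<close>
  subtracts, by \<open>U_poly_inner_off_diag\<close>, exactly the entry of \<open>U\<close> in
  column \<open>j\<close>. The other off-diagonal entries vanish already.\<close>

lemma YL_props:
  assumes "m \<le> n"
  shows "YL \<beta> \<mu> m n \<in> orth_polys \<beta> \<mu> n \<and>
    (\<forall>j\<le>n. YL \<beta> \<mu> m n \<star> bimonom j (n - j) = (if j = m then U_poly m n \<star> bimonom m (n - m) else 0))"
  using assms
proof (induction "n - m" arbitrary: m rule: less_induct)
  case less
  let ?I = "{1..(n - m) div 2}"
  have IH: "YL \<beta> \<mu> (m + 2 * i) n \<in> orth_polys \<beta> \<mu> n"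
    "j \<le> n \<Longrightarrow> YL \<beta> \<mu> (m + 2 * i) n \<star> bimonom j (n - j) =
      (if j = m + 2 * i then U_poly (m + 2 * i) n \<star> bimonom (m + 2 * i) (n - (m + 2 * i)) else 0)"
    if "i \<in> ?I" for i j
    using less.hyps[of "m + 2 * i"] less.prems that by auto
  note Y = YL_eq[of m n, unfolded UL_eq[OF less.prems]]
  have "YL \<beta> \<mu> m n \<in> orth_polys \<beta> \<mu> n"
    unfolding Y using IH(1) less.prems
    by (intro fvs.subspace_diff fvs.subspace_sum fvs.subspace_scale subspace_orth_polys U_poly_orth)
  moreover have "YL \<beta> \<mu> m n \<star> bimonom j (n - j) = (if j = m then U_poly m n \<star> bimonom m (n - m) else 0)"
    if j: "j \<le> n" for j
  proof -
    have rp: "real_polynomial_function (YL \<beta> \<mu> (m + 2 * i) n)" if "i \<in> ?I" for i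
      using IH(1)[OF that] by (rule orth_polysD)
    have "YL \<beta> \<mu> m n \<star> bimonom j (n - j) = U_poly m n \<star> bimonom j (n - j) -
      (\<Sum>i\<in>?I. c_coeff \<beta> \<mu> n i (n - m) * (YL \<beta> \<mu> (m + 2 * i) n \<star> bimonom j (n - j)))"
      unfolding Y
      using U_poly_orth[OF less.prems, THEN orth_polysD(1)] rp real_polynomial_bimonom
      by (subst W_inner_diff) (auto intro!: W_inner_sum simp: W_inner_sum)
    also have "(\<Sum>i\<in>?I. c_coeff \<beta> \<mu> n i (n - m) * (YL \<beta> \<mu> (m + 2 * i) n \<star> bimonom j (n - j))) =
      (\<Sum>i\<in>?I. if j = m + 2 * i then U_poly m n \<star> bimonom j (n - j) else 0)"
      using IH(2)[OF _ j] U_poly_inner_off_diag[of m _ n] j by (intro sum.cong) auto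
    \<comment> \<open>At most one \<open>i\<close> contributes, since \<open>j\<close> determines
      it. The range starts at 1, so the diagonal entry is not cancelled.\<close>
    also have "\<dots> = (if j = m then 0 else U_poly m n \<star> bimonom j (n - j))"
    proof (cases "\<exists>i\<in>?I. j = m + 2 * i")
      case True
      then obtain i where i: "i \<in> ?I" "j = m + 2 * i" by blast
      then have "(\<Sum>i'\<in>?I. if j = m + 2 * i' then U_poly m n \<star> bimonom j (n - j) else 0) =
        (\<Sum>i'\<in>?I. if i' = i then U_poly m n \<star> bimonom j (n - j) else 0)"
        by (intro sum.cong) auto
      then show ?thesis using i by simp
    next
      case False
      have "U_poly m n \<star> bimonom j (n - j) = 0" if "j \<noteq> m"
      proof (cases "m \<le> j")
        case True
        \<comment> \<open>An even positive difference, being at most \<open>n - m\<close>, would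
          have its half in \<open>?I\<close>.\<close>
        have "odd (j - m)"
        proof
          assume "even (j - m)"
          then obtain i where "j - m = 2 * i" by (elim evenE)
          then have "i \<in> ?I" "j = m + 2 * i" using True that j by auto
          with False show False by blast
        qed
        then show ?thesis
          using U_poly_inner[of m n j "n - j"] less.prems j mu by (simp add: jacobi_int_odd)
      qed (use U_poly_inner[of m n j "n - j"] less.prems j in simp)
      moreover have "(\<Sum>i\<in>?I. if j = m + 2 * i then U_poly m n \<star> bimonom j (n - j) else 0) = 0"
        using False by (intro sum.neutral) auto
      ultimately show ?thesis by auto
    qed
    finally show ?thesis by simp
  qed
  ultimately show ?case by blast
qed

text \<open>\<open>Y\<close> is orthogonal to the lower-degree part of \<open>V\<close>, so its
  pairing with the leading monomial carries over.\<close>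

lemma YL_VL_biorthogonal:
  assumes "k \<le> n" "j \<le> n"
  shows "YL \<beta> \<mu> k n \<star> VL \<beta> \<mu> j n = (if j = k then U_poly k n \<star> bimonom k (n - k) else 0)"
proof -
  let ?Y = "YL \<beta> \<mu> k n" and ?V = "VL \<beta> \<mu> j n" and ?e = "bimonom j (n - j)"
  have Y: "?Y \<in> orth_polys \<beta> \<mu> n" using YL_props assms by blast
  note Yp = orth_polysD(1)[OF Y] and Vp = orth_polysD(1)[OF VL_props(1)[OF assms(2)]]
  have "?V \<star> ?Y - ?e \<star> ?Y = (?V - ?e) \<star> ?Y"
    using Yp Vp real_polynomial_bimonom by (simp add: W_inner_diff)
  also have "\<dots> = 0"
    using orth_polysD(3)[OF Y VL_props(2)[OF assms(2)]] by (simp add: W_inner_commute)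
  finally have "?Y \<star> ?V = ?Y \<star> ?e" by (simp add: W_inner_commute[of \<beta> \<mu> ?Y])
  then show ?thesis using YL_props assms by simp
qed

text \<open>The monomials of degree \<open>n\<close> are the dual family, indexed backwards to match
  \<open>n - k\<close>. An element of \<open>orth_polys\<close> is orthogonal to lower degrees by
  definition, so orthogonality to these monomials makes it orthogonal to itself.\<close>

lemma YL_basis: "indexed_basis {0..n} (\<lambda>k. YL \<beta> \<mu> (n - k) n) (orth_polys \<beta> \<mu> n)"
proof (rule biorthogonal_imp_indexed_basis[where G = "\<lambda>k. bimonom (n - k) k"])
  fix i assume i: "i \<in> {0..n}"
  show "YL \<beta> \<mu> (n - i) n \<in> orth_polys \<beta> \<mu> n" using YL_props by simp
  have *: "YL \<beta> \<mu> (n - i) n \<star> bimonom (n - j) j =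
      (if j = i then U_poly (n - i) n \<star> bimonom (n - i) i else 0)" if "j \<in> {0..n}" for j
    using YL_props[of "n - i" n, THEN conjunct2, rule_format, of "n - j"] i that by auto
  show "YL \<beta> \<mu> (n - i) n \<star> bimonom (n - i) i \<noteq> 0"
    using *[OF i] U_poly_inner_diag[of "n - i" n] i by simp
  show "YL \<beta> \<mu> (n - i) n \<star> bimonom (n - j) j = 0" if "j \<in> {0..n}" "i \<noteq> j" for j
    using *[OF that(1)] that(2) by simp
next
  fix Q assume Q: "Q \<in> orth_polys \<beta> \<mu> n" and 0: "\<And>k. k \<in> {0..n} \<Longrightarrow> Q \<star> bimonom (n - k) k = 0"
  have "Q \<star> bimonom i j = 0" if "i + j < Suc n" for i j
  proof (cases "i + j = n")
    case True
    then show ?thesis using 0[of j] by auto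
  next
    case False
    then show ?thesis using that orth_polysD(3)[OF Q] bimonom_in_poly_deg_less[of i j n] by simp
  qed
  then have "Q \<star> Q = 0"
    by (rule orthogonal_poly_deg_less[OF orth_polysD(1)[OF Q] _ orth_polysD(2)[OF Q]])
  then show "Q = 0" using orth_polysD(1)[OF Q] definite by blast
next
  show "orth_polys \<beta> \<mu> n \<subseteq> Collect real_polynomial_function" using orth_polysD(1) by blast
qed (simp_all add: subspace_orth_polys real_polynomial_bimonom)

text \<open>Here \<open>Y\<close> is the dual family. An element orthogonal to all \<open>Y\<close>
  is orthogonal to their span, which contains it by \<open>YL_basis\<close>, so it is 0.\<close>

lemma VL_basis: "indexed_basis {0..n} (\<lambda>k. VL \<beta> \<mu> k n) (orth_polys \<beta> \<mu> n)"
proof (rule biorthogonal_imp_indexed_basis[where G = "\<lambda>k. YL \<beta> \<mu> k n"])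
  fix i assume i: "i \<in> {0..n}"
  show "VL \<beta> \<mu> i n \<in> orth_polys \<beta> \<mu> n" using VL_props i by simp
  have "YL \<beta> \<mu> i n \<in> orth_polys \<beta> \<mu> n" using YL_props[of i n] i by simp
  then show "real_polynomial_function (YL \<beta> \<mu> i n)" by (rule orth_polysD(1))
  have *: "VL \<beta> \<mu> i n \<star> YL \<beta> \<mu> j n = (if i = j then U_poly j n \<star> bimonom j (n - j) else 0)"
    if "j \<in> {0..n}" for j
    by (subst W_inner_commute, rule YL_VL_biorthogonal) (use i that in simp_all)
  show "VL \<beta> \<mu> i n \<star> YL \<beta> \<mu> i n \<noteq> 0"
    using *[OF i] U_poly_inner_diag[of i n] i by simp
  show "VL \<beta> \<mu> i n \<star> YL \<beta> \<mu> j n = 0" if "j \<in> {0..n}" "i \<noteq> j" for j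
    using *[OF that(1)] that(2) by simp
next
  fix Q assume Q: "Q \<in> orth_polys \<beta> \<mu> n" and 0: "\<And>k. k \<in> {0..n} \<Longrightarrow> Q \<star> YL \<beta> \<mu> k n = 0"
  have Y: "real_polynomial_function P \<and> P \<star> Q = 0" if P: "P \<in> (\<lambda>k. YL \<beta> \<mu> (n - k) n) ` {0..n}" for P
  proof -
    obtain k where k: "P = YL \<beta> \<mu> (n - k) n" using P by blast
    have "P \<in> orth_polys \<beta> \<mu> n" unfolding k using YL_props by simp
    moreover have "P \<star> Q = 0"
      unfolding k by (subst W_inner_commute) (simp add: 0)
    ultimately show ?thesis using orth_polysD(1) by blast
  qed
  have "Q \<in> fvs.span ((\<lambda>k. YL \<beta> \<mu> (n - k) n) ` {0..n})"
    using YL_basis[of n] Q by (simp add: indexed_basis_def)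
  then have "Q \<star> Q = 0"
    by (rule orthogonal_span[OF orth_polysD(1)[OF Q], rotated]) (rule Y)
  then show "Q = 0" using orth_polysD(1)[OF Q] definite by blast
next
  show "orth_polys \<beta> \<mu> n \<subseteq> Collect real_polynomial_function" using orth_polysD(1) by blast
qed (simp_all add: subspace_orth_polys)

end

theorem proposition4p4:
  fixes \<beta> \<mu> :: real and n :: nat
  assumes "\<mu> > - 1/2" and "\<beta> > - 1" and "2 * \<mu> + \<beta> + 1 > 0"
  shows "indexed_basis {0..n} (\<lambda>k. YL \<beta> \<mu> (n - k) n) (orth_polys \<beta> \<mu> n)
    \<and> indexed_basis {0..n} (\<lambda>k. VL \<beta> \<mu> k n) (orth_polys \<beta> \<mu> n)
    \<and> (\<forall>k \<le> n. \<forall>j \<le> n.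
         (k \<noteq> j \<longrightarrow> W_inner \<beta> \<mu> (YL \<beta> \<mu> k n) (VL \<beta> \<mu> j n) = 0)
       \<and> (k = j \<longrightarrow> W_inner \<beta> \<mu> (YL \<beta> \<mu> k n) (VL \<beta> \<mu> j n) \<noteq> 0))"
proof -
  interpret laguerre_cone \<beta> \<mu> using assms by unfold_locales
  show ?thesis
    using YL_basis VL_basis YL_VL_biorthogonal U_poly_inner_diag by simp
qed

end
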